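(* Let $r\geq 3$ and let $\Gamma$ be an $r$-uniform supertree with $w\in V(\Gamma)$. Let $u$ be a pendent vertex (a vertex of degree $1$) of the pendent edge of $\mathcal{R}(1,1,2,4)$ attached at $v_3$, and let $v$ be a pendent vertex of the pendent edge of $\mathcal{R}(1,3,1,3)$ attached at $v_6$. Then $\rho(\mathcal{R}(1,1,2,4)_u\cdot\Gamma_w)=\rho(\mathcal{R}(1,3,1,3)_v\cdot\Gamma_w)$ and $ME(\mathcal{R}(1,1,2,4)_u\cdot\Gamma_w)=ME(\mathcal{R}(1,3,1,3)_v\cdot\Gamma_w)$.
   Context: An $r$-uniform supertree is a connected acyclic hypergraph each of whose edges has exactly $r$ vertices. The loose path $\mathcal{P}^r_t=v_1e_1v_2\cdots v_te_tv_{t+1}$ of length $t$ has edges $e_i=\{v_i,u_{i,1},\dots,u_{i,r-2},v_{i+1}\}$ with all listed vertices distinct. For positive integers $a,b,c,d$, $\mathcal{R}(a,b,c,d)$ is obtained from $\mathcal{P}^r_{a+b+c+d}$ by attaching one pendent edge (an edge containing one existing vertex and $r-1$ new vertices) at each of the vertices $v_{a+1}$, $v_{a+b+1}$ and $v_{a+b+c+1}$. $\mathcal{R}_u\cdot\Gamma_w$ denotes the hypergraph obtained from disjoint $\mathcal{R}$ and $\Gamma$ by identifying $u$ with $w$. For an $r$-uniform hypergraph $\mathcal{H}$ on $n$ vertices, $m(\mathcal{H},k)$ is the number of sets of $k$ pairwise disjoint edges ($m(\mathcal{H},0)=1$), $\varphi(\mathcal{H},x)=\sum_{k\geq0}(-1)^km(\mathcal{H},k)x^{n-kr}$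 is its matching polynomial, and $ME(\mathcal{H})$ is the sum of absolute values of all roots (with multiplicity) of $\varphi(\mathcal{H},x)$. The adjacency tensor has entries $a_{i_1\cdots i_r}=1/(r-1)!$ if $\{i_1,\dots,i_r\}$ is an edge and $0$ otherwise; $\lambda$ is an eigenvalue if some nonzero $x\in\mathbb{C}^n$ satisfies $\sum_{i_2,\dots,i_r}a_{ii_2\cdots i_r}x_{i_2}\cdots x_{i_r}=\lambda x_i^{r-1}$ for all $i$; $\rho(\mathcal{H})$ is the maximum modulus of the eigenvalues. *)

theory Defs
  imports "HOL-Computational_Algebra.Polynomial" "HOL-Analysis.Analysis"
begin

section \<open>Hypergraphs (vertex set V, edge set E)\<close>

definition uniform_hg :: "nat \<Rightarrow> 'a set \<Rightarrow> 'a set set \<Rightarrow> bool" where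
  "uniform_hg r V E \<longleftrightarrow> finite V \<and> (\<forall>e\<in>E. e \<subseteq> V \<and> card e = r)"

definition hg_degree :: "'a set set \<Rightarrow> 'a \<Rightarrow> nat" where
  "hg_degree E v = card {e\<in>E. v \<in> e}"

definition hg_connected :: "'a set \<Rightarrow> 'a set set \<Rightarrow> bool" where
  "hg_connected V E \<longleftrightarrow>
     (\<forall>x\<in>V. \<forall>y\<in>V. (x, y) \<in> ({(a, b). \<exists>e\<in>E. a \<in> e \<and> b \<in> e})\<^sup>*)"

text \<open>Berge cycle v_0 e_0 v_1 e_1 ... v_(k-1) e_(k-1) v_0, k >= 2,
  distinct vertices and distinct edges.\<close>
definition berge_cycle :: "'a set set \<Rightarrow> 'a list \<Rightarrow> 'a set list \<Rightarrow> bool" where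
  "berge_cycle E vs es \<longleftrightarrow>
     length vs = length es \<and> length vs \<ge> 2 \<and> distinct vs \<and> distinct es \<and> set es \<subseteq> E \<and>
     (\<forall>i < length vs. vs ! i \<in> es ! i \<and> vs ! ((i + 1) mod length vs) \<in> es ! i)"

definition hg_acyclic :: "'a set set \<Rightarrow> bool" where
  "hg_acyclic E \<longleftrightarrow> \<not> (\<exists>vs es. berge_cycle E vs es)"

definition supertree :: "nat \<Rightarrow> 'a set \<Rightarrow> 'a set set \<Rightarrow> bool" where
  "supertree r V E \<longleftrightarrow> uniform_hg r V E \<and> hg_connected V E \<and> hg_acyclic E"

section \<open>Matching polynomial and matching energy\<close>

definition matchings :: "'a set set \<Rightarrow> nat \<Rightarrow> 'a set set set" where
  "matchings E k = {M. M \<subseteq> E \<and> card M = k \<and> (\<forall>e\<in>M. \<forall>f\<in>M. e \<noteq> f \<longrightarrow> e \<inter> f = {})}"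

definition match_num :: "'a set set \<Rightarrow> nat \<Rightarrow> nat" where
  "match_num E k = card (matchings E k)"

text \<open>m(H,k) = 0 for k > |E|, so summing over k <= |E| is the full sum.\<close>
definition matching_poly :: "nat \<Rightarrow> 'a set \<Rightarrow> 'a set set \<Rightarrow> complex poly" where
  "matching_poly r V E =
     (\<Sum>k\<le>card E. monom ((-1) ^ k * of_nat (match_num E k)) (card V - k * r))"

definition matching_energy :: "nat \<Rightarrow> 'a set \<Rightarrow> 'a set set \<Rightarrow> real" where
  "matching_energy r V E =
     (\<Sum>z\<in>{z. poly (matching_poly r V E) z = 0}.
        of_nat (order z (matching_poly r V E)) * cmod z)"

section \<open>Adjacency tensor, eigenvalues, spectral radius\<close>

text \<open>Entry a_{i_1 ... i_r}, indices given as a list of length r.\<close>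
definition adj_tensor :: "nat \<Rightarrow> 'a set set \<Rightarrow> 'a list \<Rightarrow> real" where
  "adj_tensor r E idx = (if set idx \<in> E then 1 / fact (r - 1) else 0)"

definition tensor_eigenvalue :: "nat \<Rightarrow> 'a set \<Rightarrow> 'a set set \<Rightarrow> complex \<Rightarrow> bool" where
  "tensor_eigenvalue r V E lam \<longleftrightarrow>
     (\<exists>x :: 'a \<Rightarrow> complex. (\<exists>i\<in>V. x i \<noteq> 0) \<and>
        (\<forall>i\<in>V. (\<Sum>js\<in>{js. length js = r - 1 \<and> set js \<subseteq> V}.
                    complex_of_real (adj_tensor r E (i # js)) * prod_list (map x js))
                 = lam * x i ^ (r - 1)))"

definition spectral_radius :: "nat \<Rightarrow> 'a set \<Rightarrow> 'a set set \<Rightarrow> real" where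
  "spectral_radius r V E = Sup (cmod ` {lam. tensor_eigenvalue r V E lam})"

section \<open>The hypergraphs R(a,b,c,d)\<close>

text \<open>PV i = path vertex v_i; IV i j = u_{i,j} (inner vertex of path edge e_i);
  NV k j = j-th new vertex of the pendent edge attached at v_k.\<close>
datatype rvert = PV nat | IV nat nat | NV nat nat

definition path_edge :: "nat \<Rightarrow> nat \<Rightarrow> rvert set" where
  "path_edge r i = {PV i, PV (Suc i)} \<union> {IV i j | j. 1 \<le> j \<and> j \<le> r - 2}"

definition pend_edge :: "nat \<Rightarrow> nat \<Rightarrow> rvert set" where
  "pend_edge r k = {PV k} \<union> {NV k j | j. 1 \<le> j \<and> j \<le> r - 1}"

definition R_edges :: "nat \<Rightarrow> nat \<Rightarrow> nat \<Rightarrow> nat \<Rightarrow> nat \<Rightarrow> rvert set set" where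
  "R_edges r a b c d =
     {path_edge r i | i. 1 \<le> i \<and> i \<le> a + b + c + d} \<union>
     {pend_edge r (a + 1), pend_edge r (a + b + 1), pend_edge r (a + b + c + 1)}"

definition R_verts :: "nat \<Rightarrow> nat \<Rightarrow> nat \<Rightarrow> nat \<Rightarrow> nat \<Rightarrow> rvert set" where
  "R_verts r a b c d = \<Union> (R_edges r a b c d)"

section \<open>Coalescence R_u . Gamma_w (u identified with w)\<close>

definition glue_map :: "'b \<Rightarrow> 'a \<Rightarrow> 'b \<Rightarrow> 'b + 'a" where
  "glue_map u w x = (if x = u then Inr w else Inl x)"

definition coal_verts :: "'b set \<Rightarrow> 'b \<Rightarrow> 'a set \<Rightarrow> 'a \<Rightarrow> ('b + 'a) set" where
  "coal_verts VR u VG w = glue_map u w ` VR \<union> Inr ` VG"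

definition coal_edges :: "'b set set \<Rightarrow> 'b \<Rightarrow> 'a set set \<Rightarrow> 'a \<Rightarrow> ('b + 'a) set set" where
  "coal_edges ER u EG w = image (glue_map u w) ` ER \<union> image Inr ` EG"

end

theory Submission
  imports Defs "HOL-Combinatorics.Multiset_Permutations"
begin

text \<open>
  Both hypergraphs arise from the loose path of length 8 with pendent edges at \<open>v_2\<close> and \<open>v_5\<close>, put
  next to \<open>\<Gamma>\<close>, by adding one linking edge through \<open>w\<close> and \<open>v_3\<close>, respectively \<open>v_6\<close>.

  Matchings avoiding the linking edge are the same for both. Those containing it are matchings of
  what remains after deleting \<open>w\<close> and \<open>v_3\<close> (respectively \<open>v_6\<close>), and the two remainders are
  isomorphic up to isolated vertices. So the matching polynomials coincide.

  A positive eigenvector determines the spectral radius. One exists for the first hypergraph, by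
  maximising \<open>\<Sum>\<^sub>e \<Prod>\<^sub>i\<^sub>\<in>\<^sub>e x_i\<close> on the sphere \<open>\<Sum> x_i^r = 1\<close>. In an edge, all vertices of degree 1
  carry the same entry, which can be eliminated; for \<open>z_m = x(v_m)^(r/2)\<close> and \<open>s = \<lambda>^(r/2)\<close> the
  equations on the path part become the linear eigenvalue equations of an ordinary tree. These
  have an explicit positive solution for the second hypergraph with the same values at the linking
  edge, so the eigenvector on \<open>\<Gamma>\<close> extends to it with the same \<open>\<lambda>\<close>.
\<close>

section \<open>Positive eigenvectors and the spectral radius\<close>

lemma uniform_hg_finite_edges: "uniform_hg r V E \<Longrightarrow> finite E"
  unfolding uniform_hg_def by (meson Pow_iff finite_Pow_iff finite_subset subsetI)

lemma uniform_hg_edgeD: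
  assumes "uniform_hg r V E" "e \<in> E"
  shows "e \<subseteq> V" "card e = r" "finite e"
  using assms finite_subset unfolding uniform_hg_def by blast+

text \<open>The only index lists with a nonzero entry are the orderings of \<open>e - {i}\<close>
  for the edges \<open>e\<close> through \<open>i\<close>. Each edge has \<open>(r - 1)!\<close> of
  them, which cancels the factor \<open>1 / fact (r - 1)\<close>.\<close>

lemma adj_tensor_sum:
  fixes x :: "'a \<Rightarrow> complex"
  assumes H: "uniform_hg r V E" and r: "r \<ge> 1"
  shows "(\<Sum>js\<in>{js. length js = r - 1 \<and> set js \<subseteq> V}.
            complex_of_real (adj_tensor r E (i # js)) * prod_list (map x js))
         = (\<Sum>e\<in>{e\<in>E. i \<in> e}. \<Prod>j\<in>e - {i}. x j)"
proof -
  let ?S = "{js. length js = r - 1 \<and> set js \<subseteq> V}"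
  let ?T = "\<Union>e\<in>{e\<in>E. i \<in> e}. permutations_of_set (e - {i})"
  let ?f = "\<lambda>js. complex_of_real (adj_tensor r E (i # js)) * prod_list (map x js)"
  have finV: "finite V" using H unfolding uniform_hg_def by blast
  have finS: "finite ?S"
    using finite_lists_length_eq[OF finV, of "r - 1"] by (simp add: conj_commute)
  have T_sub: "?T \<subseteq> ?S"
  proof
    fix js assume "js \<in> ?T"
    then obtain e where e: "e \<in> E" "i \<in> e" "js \<in> permutations_of_set (e - {i})" by blast
    then have "set js = e - {i}" "distinct js" by (auto simp: permutations_of_set_def)
    moreover have "card (e - {i}) = r - 1" using uniform_hg_edgeD[OF H e(1)] e(2) by simp
    ultimately show "js \<in> ?S"
      using uniform_hg_edgeD(1)[OF H e(1)] distinct_card[of js] by auto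
  qed
  have zero: "?f js = 0" if js: "js \<in> ?S - ?T" for js
  proof -
    have "insert i (set js) \<notin> E"
    proof
      assume e: "insert i (set js) \<in> E"
      have "card (insert i (set js)) = r" by (rule uniform_hg_edgeD(2)[OF H e])
      moreover have "card (set js) \<le> r - 1" using js card_length[of js] by auto
      ultimately have "i \<notin> set js" "card (set js) = length js"
        using js r by (auto simp: card_insert_if split: if_splits)
      then have "js \<in> permutations_of_set (insert i (set js) - {i})"
        by (auto simp: permutations_of_set_def card_distinct)
      then show False using js e by blast
    qed
    then show ?thesis by (simp add: adj_tensor_def)
  qed
  have inner: "(\<Sum>js\<in>permutations_of_set (e - {i}). ?f js) = (\<Prod>j\<in>e - {i}. x j)"
    if e: "e \<in> E" "i \<in> e" for e
  proof -
    have fe: "finite (e - {i})" and ce: "card (e - {i}) = r - 1"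
      using uniform_hg_edgeD[OF H e(1)] e(2) by auto
    have "?f js = (1 / fact (r - 1)) * (\<Prod>j\<in>e - {i}. x j)"
      if "js \<in> permutations_of_set (e - {i})" for js
    proof -
      have "set js = e - {i}" "distinct js" using that by (auto simp: permutations_of_set_def)
      then show ?thesis
        using e by (simp add: adj_tensor_def insert_absorb prod.distinct_set_conv_list[symmetric])
    qed
    then have "(\<Sum>js\<in>permutations_of_set (e - {i}). ?f js)
        = (\<Sum>js\<in>permutations_of_set (e - {i}). (1 / fact (r - 1)) * (\<Prod>j\<in>e - {i}. x j))"
      by (rule sum.cong[OF refl])
    also have "\<dots> = (\<Prod>j\<in>e - {i}. x j)"
      using card_permutations_of_set[OF fe] by (simp add: ce)
    finally show ?thesis .
  qed
  have "(\<Sum>js\<in>?S. ?f js) = (\<Sum>js\<in>?T. ?f js)"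
    by (rule sum.mono_neutral_right[OF finS T_sub], rule ballI, rule zero)
  also have "\<dots> = (\<Sum>e\<in>{e\<in>E. i \<in> e}. \<Sum>js\<in>permutations_of_set (e - {i}). ?f js)"
  proof (rule sum.UNION_disjoint)
    show "finite {e \<in> E. i \<in> e}" using uniform_hg_finite_edges[OF H] by simp
    show "\<forall>e\<in>{e \<in> E. i \<in> e}. finite (permutations_of_set (e - {i}))" by simp
    show "\<forall>e\<in>{e \<in> E. i \<in> e}. \<forall>e'\<in>{e \<in> E. i \<in> e}. e \<noteq> e' \<longrightarrow>
            permutations_of_set (e - {i}) \<inter> permutations_of_set (e' - {i}) = {}"
      by (auto simp: permutations_of_set_def)
  qed
  also have "\<dots> = (\<Sum>e\<in>{e\<in>E. i \<in> e}. \<Prod>j\<in>e - {i}. x j)"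
    by (rule sum.cong[OF refl]) (use inner in blast)
  finally show ?thesis .
qed

text \<open>The eigenvalue equation at \<open>i\<close> multiplied by \<open>x i\<close>, which makes it symmetric in the
  vertices of each edge.\<close>

definition positive_eigenvector ::
    "nat \<Rightarrow> 'a set \<Rightarrow> 'a set set \<Rightarrow> real \<Rightarrow> ('a \<Rightarrow> real) \<Rightarrow> bool" where
  "positive_eigenvector r V E lam x \<longleftrightarrow>
     (\<forall>i\<in>V. x i > 0 \<and> lam * x i ^ r = (\<Sum>e\<in>{e\<in>E. i \<in> e}. \<Prod>j\<in>e. x j))"

text \<open>The positive eigenvector serves as a weight: at a vertex where
  \<open>cmod (y i) / x i\<close> is largest, the triangle inequality in the equation for any
  eigenvector \<open>y\<close> bounds its eigenvalue by \<open>lam\<close>.\<close>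

lemma spectral_radius_eq_positive_eigenvalue:
  assumes H: "uniform_hg r V E" and r: "r \<ge> 1" and V: "V \<noteq> {}"
    and x: "positive_eigenvector r V E lam x"
  shows "spectral_radius r V E = lam"
proof -
  have finV: "finite V" using H unfolding uniform_hg_def by blast
  have pos: "x i > 0" if "i \<in> V" for i using x that unfolding positive_eigenvector_def by blast
  have eq: "(\<Sum>e\<in>{e\<in>E. i \<in> e}. \<Prod>j\<in>e - {i}. x j) = lam * x i ^ (r - 1)" if i: "i \<in> V" for i
  proof -
    have "x i * (\<Sum>e\<in>{e\<in>E. i \<in> e}. \<Prod>j\<in>e - {i}. x j) = (\<Sum>e\<in>{e\<in>E. i \<in> e}. \<Prod>j\<in>e. x j)"
      unfolding sum_distrib_left
      by (rule sum.cong) (auto simp: prod.remove uniform_hg_edgeD[OF H])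
    also have "\<dots> = lam * x i ^ r" using x i unfolding positive_eigenvector_def by simp
    also have "\<dots> = x i * (lam * x i ^ (r - 1))"
      using r by (cases r) auto
    finally show ?thesis using pos[OF i] by simp
  qed
  have lam0: "lam \<ge> 0"
  proof -
    obtain i where i: "i \<in> V" using V by blast
    have "lam * x i ^ (r - 1) \<ge> 0" unfolding eq[OF i, symmetric]
      by (intro sum_nonneg prod_nonneg)
        (use pos uniform_hg_edgeD(1)[OF H] in \<open>fastforce intro: less_imp_le\<close>)
    then show ?thesis using zero_less_power[OF pos[OF i], of "r - 1"] by (simp add: zero_le_mult_iff)
  qed
  have eig: "tensor_eigenvalue r V E (complex_of_real lam)"
    unfolding tensor_eigenvalue_def adj_tensor_sum[OF H r]
  proof (intro exI[of _ "\<lambda>i. complex_of_real (x i)"] conjI ballI)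
    show "\<exists>i\<in>V. complex_of_real (x i) \<noteq> 0" using V pos by fastforce
    fix i assume "i \<in> V"
    then show "(\<Sum>e\<in>{e\<in>E. i \<in> e}. \<Prod>j\<in>e - {i}. complex_of_real (x j))
        = complex_of_real lam * complex_of_real (x i) ^ (r - 1)"
      using arg_cong[OF eq, of i complex_of_real] by simp
  qed
  have bound: "cmod mu \<le> lam" if mu: "tensor_eigenvalue r V E mu" for mu
  proof -
    obtain y where nz: "\<exists>i\<in>V. y i \<noteq> 0" and
      y: "\<And>i. i \<in> V \<Longrightarrow> (\<Sum>e\<in>{e\<in>E. i \<in> e}. \<Prod>j\<in>e - {i}. y j) = mu * y i ^ (r - 1)"
      using mu unfolding tensor_eigenvalue_def adj_tensor_sum[OF H r] by blast
    let ?q = "\<lambda>i. cmod (y i) / x i"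
    define M where "M = Max (?q ` V)"
    have M: "?q i \<le> M" if "i \<in> V" for i unfolding M_def using finV that by simp
    obtain i where i: "i \<in> V" "?q i = M"
    proof -
      have "M \<in> ?q ` V" unfolding M_def by (rule Max_in) (use finV V in auto)
      then show thesis using that by auto
    qed
    have le: "cmod (y j) \<le> M * x j" if "j \<in> V" for j
      using M[OF that] pos[OF that] by (simp add: divide_le_eq)
    have yi: "cmod (y i) = M * x i" using i(2) pos[OF i(1)] by (auto simp: divide_eq_eq)
    obtain k where k: "k \<in> V" "y k \<noteq> 0" using nz by blast
    have "0 < ?q k" using k pos by simp
    then have Mpos: "M > 0" using M[OF k(1)] by linarith
    have "cmod mu * cmod (y i) ^ (r - 1) = cmod (\<Sum>e\<in>{e\<in>E. i \<in> e}. \<Prod>j\<in>e - {i}. y j)"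
      unfolding y[OF i(1)] by (simp add: norm_mult norm_power)
    also have "\<dots> \<le> (\<Sum>e\<in>{e\<in>E. i \<in> e}. cmod (\<Prod>j\<in>e - {i}. y j))" by (rule norm_sum)
    \<comment> \<open>Each product has \<open>r - 1\<close> factors, each at most
      \<open>M * x j\<close>. The left side started from \<open>cmod (y i) = M * x i\<close>, so the
      same power of \<open>M\<close> appears on both sides and cancels.\<close>
    also have "\<dots> \<le> (\<Sum>e\<in>{e\<in>E. i \<in> e}. M ^ (r - 1) * (\<Prod>j\<in>e - {i}. x j))"
    proof (rule sum_mono)
      fix e assume e: "e \<in> {e\<in>E. i \<in> e}"
      have c: "card (e - {i}) = r - 1" using e uniform_hg_edgeD[OF H] by simp
      have "cmod (\<Prod>j\<in>e - {i}. y j) = (\<Prod>j\<in>e - {i}. cmod (y j))" by (simp add: prod_norm)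
      also have "\<dots> \<le> (\<Prod>j\<in>e - {i}. M * x j)"
        by (intro prod_mono) (use le e uniform_hg_edgeD(1)[OF H] in auto)
      also have "\<dots> = M ^ (r - 1) * (\<Prod>j\<in>e - {i}. x j)" by (simp add: prod.distrib c)
      finally show "cmod (\<Prod>j\<in>e - {i}. y j) \<le> M ^ (r - 1) * (\<Prod>j\<in>e - {i}. x j)" .
    qed
    also have "\<dots> = lam * cmod (y i) ^ (r - 1)"
      unfolding sum_distrib_left[symmetric] eq[OF i(1)] yi by (simp add: power_mult_distrib)
    finally show ?thesis using Mpos pos[OF i(1)] by (simp add: yi)
  qed
  show ?thesis unfolding spectral_radius_def
  proof (rule cSup_eq_maximum)
    have "lam = cmod (complex_of_real lam)" using lam0 by simp
    then show "lam \<in> cmod ` {lam. tensor_eigenvalue r V E lam}" using eig by blast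
  qed (use bound in auto)
qed

text \<open>A maximiser of \<open>P\<close> on the nonnegative unit sphere exists by compactness. It
  has no zero entry, because zeros would spread over edges to all of \<open>V\<close>; being
  interior, it is stationary in every coordinate, and this is the eigenvalue equation.\<close>

lemma positive_eigenvector_exists:
  assumes H: "uniform_hg r V E" and conn: "hg_connected V E" and E: "E \<noteq> {}" and r: "r \<ge> 1"
  shows "\<exists>lam x. lam > 0 \<and> positive_eigenvector r V E lam x"
proof -
  define P where "P x = (\<Sum>e\<in>E. \<Prod>j\<in>e. x j)" for x :: "'a \<Rightarrow> real"
  define N where "N x = (\<Sum>i\<in>V. x i ^ r)" for x :: "'a \<Rightarrow> real"
  \<comment> \<open>Functions are total on the vertex type, so the coordinates outside
    \<open>V\<close> are pinned to 0. This makes \<open>B\<close> a product of compact sets, compact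
    by Tychonoff.\<close>
  define B :: "('a \<Rightarrow> real) set" where "B = Pi UNIV (\<lambda>i. if i \<in> V then {0..1} else {0})"
  define S where "S = B \<inter> {x. N x = 1}"
  have finV: "finite V" using H unfolding uniform_hg_def by blast
  have finE: "finite E" by (rule uniform_hg_finite_edges[OF H])
  note edgeD = uniform_hg_edgeD[OF H]
  have edge_ne: "e \<noteq> {}" if "e \<in> E" for e using edgeD(2)[OF that] r by auto
  then obtain i0 where i0: "i0 \<in> V" using E edgeD(1) by blast
  have contP: "continuous_on A P" for A
    unfolding P_def by (intro continuous_intros continuous_on_subset[OF continuous_on_product_coordinates]) auto
  have contN: "continuous_on A N" for A
    unfolding N_def by (intro continuous_intros continuous_on_subset[OF continuous_on_product_coordinates]) auto
  have "compactin (product_topology (\<lambda>i. euclidean) UNIV) (PiE UNIV (\<lambda>i::'a. if i \<in> V then {0..1::real} else {0}))"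
    by (subst compactin_PiE) auto
  then have "compact B"
    unfolding B_def by (simp add: PiE_UNIV_domain euclidean_product_topology)
  moreover have "closed {x. N x = 1}"
    using continuous_closed_preimage[OF contN closed_UNIV, of "{1}"] by (simp add: vimage_def)
  ultimately have "compact S" unfolding S_def by (rule compact_Int_closed)
  moreover have "(\<lambda>i. if i = i0 then 1 else 0) \<in> S"
  proof -
    have "N (\<lambda>i. if i = i0 then 1 else 0) = (\<Sum>i\<in>V. if i = i0 then 1 else 0)"
      unfolding N_def by (rule sum.cong) (use r in auto)
    then show ?thesis using i0 finV unfolding S_def B_def by auto
  qed
  ultimately obtain x where xS: "x \<in> S" and x_max: "\<And>y. y \<in> S \<Longrightarrow> P y \<le> P x"
    using continuous_attains_sup[of S P] contP by blast
  define c where "c = P x"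
  have x0: "x i \<ge> 0" if "i \<in> V" for i
    using xS that unfolding S_def B_def Pi_def by (auto dest!: spec[of _ i])
  have Nx: "N x = 1" using xS unfolding S_def by simp
  \<comment> \<open>\<open>P\<close> and \<open>N\<close> are both homogeneous of degree
    \<open>r\<close>, so dividing \<open>y\<close> by the \<open>r\<close>-th root of
    \<open>N y\<close> moves it into \<open>S\<close> and turns the maximum into an inequality for
    all nonnegative \<open>y\<close>.\<close>
  have P_le: "P y \<le> c * N y" if y: "\<And>i. i \<in> V \<Longrightarrow> y i \<ge> 0" and Ny: "N y > 0" for y
  proof -
    define n where "n = root r (N y)"
    have n: "n > 0" "n ^ r = N y" using Ny r unfolding n_def by auto
    define y' where "y' i = (if i \<in> V then y i / n else 0)" for i
    have "N y' = (\<Sum>i\<in>V. y i ^ r / N y)"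
      unfolding N_def[of y'] by (rule sum.cong) (auto simp: y'_def power_divide n)
    also have "\<dots> = 1" unfolding sum_divide_distrib[symmetric] N_def[symmetric] using Ny by simp
    finally have Ny': "N y' = 1" .
    have y'0: "y' i \<ge> 0" for i using y n unfolding y'_def by simp
    have "y' i \<le> 1" if "i \<in> V" for i
    proof -
      have "y' i ^ r \<le> N y'" unfolding N_def
        by (rule member_le_sum[OF that]) (use y'0 finV in auto)
      then have "y' i ^ r \<le> 1 ^ r" by (simp add: Ny')
      then show ?thesis using r by (subst (asm) power_mono_iff) (use y'0 in auto)
    qed
    then have "y' \<in> S" using Ny' y y'0 n unfolding S_def B_def by (auto simp: y'_def)
    then have "P y' \<le> c" using x_max unfolding c_def by blast
    moreover have "P y' = P y / N y"
      unfolding P_def sum_divide_distrib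
    proof (rule sum.cong[OF refl])
      fix e assume e: "e \<in> E"
      have "(\<Prod>j\<in>e. y' j) = (\<Prod>j\<in>e. y j / n)"
        by (rule prod.cong) (use edgeD(1)[OF e] in \<open>auto simp: y'_def\<close>)
      then show "(\<Prod>j\<in>e. y' j) = (\<Prod>j\<in>e. y j) / N y"
        by (simp add: prod_dividef edgeD(2)[OF e] n)
    qed
    ultimately show ?thesis using Ny by (simp add: divide_le_eq)
  qed
  have c0: "c \<ge> 0" unfolding c_def P_def
    by (intro sum_nonneg prod_nonneg) (use x0 edgeD(1) in blast)
  have edge_zero: "\<forall>j\<in>e. x j = 0" if e: "e \<in> E" and z: "z \<in> e" "x z = 0" for e z
  proof (rule ccontr)
    \<comment> \<open>Raising the \<open>k < r\<close> zero entries of \<open>e\<close> to \<open>\<epsilon>\<close> gains order \<open>\<epsilon>^k\<close> in \<open>P\<close> but costs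
      only order \<open>\<epsilon>^r\<close> in \<open>N\<close>.\<close>
    assume nz: "\<not> (\<forall>j\<in>e. x j = 0)"
    define Z where "Z = {j\<in>e. x j = 0}"
    have fe: "finite e" and Ze: "Z \<subseteq> e" and ZV: "Z \<subseteq> V"
      using edgeD[OF e] unfolding Z_def by auto
    have fZ: "finite Z" using fe Ze finite_subset by blast
    have "Z \<subset> e" using nz unfolding Z_def by blast
    then have kr: "card Z < r" using psubset_card_mono[OF fe] edgeD(2)[OF e] by simp
    define C where "C = (\<Prod>j\<in>e - Z. x j)"
    have C: "C > 0" unfolding C_def
    proof (rule prod_pos)
      fix j assume "j \<in> e - Z"
      then show "x j > 0" using x0[of j] edgeD(1)[OF e] unfolding Z_def by force
    qed
    \<comment> \<open>Small enough that \<open>c * card Z * eps\<close> is at most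
      \<open>C / 2\<close>. The bound 1 allows comparing powers of \<open>eps\<close>, and the
      summand 1 in the denominator keeps it positive while only \<open>c \<ge> 0\<close> is
      known.\<close>
    define eps where "eps = min 1 (C / (2 * (c * card Z + 1)))"
    have den: "c * card Z + 1 > 0" using c0 by (simp add: add_nonneg_pos)
    have eps: "0 < eps" "eps \<le> 1" unfolding eps_def using C den by auto
    define y where "y j = (if j \<in> Z then eps else x j)" for j
    have yx: "x j \<le> y j" for j using eps unfolding y_def Z_def by auto
    have y0: "y i \<ge> 0" if "i \<in> V" for i using x0[OF that] yx[of i] by linarith
    have "N y = (\<Sum>i\<in>V. x i ^ r + (if i \<in> Z then eps ^ r else 0))"
      unfolding N_def by (rule sum.cong) (use r in \<open>auto simp: y_def Z_def\<close>)
    also have "\<dots> = N x + card Z * eps ^ r"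
      unfolding N_def sum.distrib using finV ZV by (simp add: sum.If_cases Int_absorb1)
    finally have Ny: "N y = 1 + card Z * eps ^ r" using Nx by simp
    have "(\<Prod>j\<in>e. y j) = (\<Prod>j\<in>e - Z. y j) * (\<Prod>j\<in>Z. y j)"
      by (rule prod.subset_diff[OF Ze fe])
    also have "\<dots> = C * eps ^ card Z"
      unfolding C_def y_def by (simp add: prod.If_cases)
    finally have ye: "(\<Prod>j\<in>e. y j) = C * eps ^ card Z" .
    have xe: "(\<Prod>j\<in>e. x j) = 0" using fe z by auto
    have "P x = (\<Sum>f\<in>E - {e}. \<Prod>j\<in>f. x j)"
      unfolding P_def using finE e xe by (simp add: sum.remove)
    also have "\<dots> \<le> (\<Sum>f\<in>E - {e}. \<Prod>j\<in>f. y j)"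
      by (intro sum_mono prod_mono) (use x0 yx edgeD(1) in blast)
    finally have "P x + C * eps ^ card Z \<le> P y"
      unfolding P_def using finE e ye by (simp add: sum.remove)
    also have "\<dots> \<le> c * (1 + card Z * eps ^ r)"
      unfolding Ny[symmetric] by (rule P_le[OF y0]) (use eps in \<open>auto simp: Ny add_pos_nonneg\<close>)
    finally have "C * eps ^ card Z \<le> c * card Z * eps ^ r"
      unfolding c_def by (simp add: algebra_simps)
    also have "\<dots> \<le> c * card Z * eps ^ Suc (card Z)"
      by (intro mult_left_mono power_decreasing) (use kr eps c0 in auto)
    finally have "C * eps ^ card Z \<le> (c * card Z * eps) * eps ^ card Z" by (simp add: mult_ac)
    then have "C \<le> c * card Z * eps" using eps by simp
    also have "\<dots> \<le> (c * card Z + 1) * (C / (2 * (c * card Z + 1)))"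
      by (intro mult_mono) (use den c0 eps C in \<open>auto simp: eps_def\<close>)
    also have "\<dots> = C / 2"
      using den nonzero_mult_divide_mult_cancel_left[of "c * card Z + 1" C 2]
      by (simp only: times_divide_eq_right mult.commute[of 2])
    finally show False using C by simp
  qed
  have xpos: "x i > 0" if i: "i \<in> V" for i
  proof -
    have "\<exists>k\<in>V. x k \<noteq> 0"
    proof (rule ccontr)
      assume "\<not> (\<exists>k\<in>V. x k \<noteq> 0)"
      then have "N x = 0" unfolding N_def using r by (intro sum.neutral) auto
      then show False using Nx by simp
    qed
    then obtain k where k: "k \<in> V" "x k \<noteq> 0" by blast
    \<comment> \<open>By \<open>edge_zero\<close>, a nonzero entry forces nonzero entries on every
      edge through it, hence along any walk from \<open>k\<close>.\<close>
    have "(k, i) \<in> {(a, b). \<exists>e\<in>E. a \<in> e \<and> b \<in> e}\<^sup>*"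
      using conn k(1) i unfolding hg_connected_def by blast
    then have "x i \<noteq> 0"
    proof (induction rule: rtrancl_induct)
      case base
      show ?case by (rule k(2))
    next
      case (step a b)
      then show ?case using edge_zero by blast
    qed
    then show ?thesis using x0[OF i] by linarith
  qed
  have cpos: "c > 0" unfolding c_def P_def
    by (intro sum_pos finE E prod_pos) (use xpos edgeD(1) in blast)
  have "c * r * x i ^ r = (\<Sum>e\<in>{e\<in>E. i \<in> e}. \<Prod>j\<in>e. x j)" if i: "i \<in> V" for i
  proof -
    define N' where "N' = (\<Sum>j\<in>V - {i}. x j ^ r)"
    define P0 where "P0 = (\<Sum>e\<in>{e\<in>E. i \<notin> e}. \<Prod>j\<in>e. x j)"
    define P1 where "P1 = (\<Sum>e\<in>{e\<in>E. i \<in> e}. \<Prod>j\<in>e - {i}. x j)"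
    have Nh: "N (x(i := h)) = N' + h ^ r" for h
      unfolding N_def N'_def using finV i by (simp add: sum.remove[of V i])
    have Ph: "P (x(i := h)) = P0 + P1 * h" for h
    proof -
      have split: "E = {e\<in>E. i \<notin> e} \<union> {e\<in>E. i \<in> e}" by blast
      have "P (x(i := h)) = (\<Sum>e\<in>{e\<in>E. i \<notin> e}. \<Prod>j\<in>e. (x(i := h)) j)
          + (\<Sum>e\<in>{e\<in>E. i \<in> e}. \<Prod>j\<in>e. (x(i := h)) j)"
        unfolding P_def by (subst split, rule sum.union_disjoint) (use finE in auto)
      also have "(\<Sum>e\<in>{e\<in>E. i \<notin> e}. \<Prod>j\<in>e. (x(i := h)) j) = P0"
        unfolding P0_def by (intro sum.cong prod.cong) auto
      also have "(\<Sum>e\<in>{e\<in>E. i \<in> e}. \<Prod>j\<in>e. (x(i := h)) j) = P1 * h"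
        unfolding P1_def sum_distrib_right
        by (intro sum.cong) (auto simp: prod.remove[of _ i] edgeD(3))
      finally show ?thesis .
    qed
    \<comment> \<open>Varying one coordinate alone: \<open>P\<close> is affine in it and
      \<open>N\<close> is its \<open>r\<close>-th power plus a constant. By \<open>P_le\<close>,
      \<open>g\<close> is nonnegative on positive arguments and it vanishes at \<open>x i\<close>,
      so its derivative there is 0. Differentiating \<open>h ^ r\<close> produces the factor
      \<open>r\<close> in the eigenvalue \<open>c * r\<close>.\<close>
    define g where "g h = c * (N' + h ^ r) - (P0 + P1 * h)" for h
    have N'0: "N' \<ge> 0" unfolding N'_def by (intro sum_nonneg) (use x0 in auto)
    have g0: "g h \<ge> 0" if "h > 0" for h
    proof -
      have "P (x(i := h)) \<le> c * N (x(i := h))"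
        by (rule P_le) (use that x0 N'0 in \<open>auto simp: Nh add_nonneg_pos\<close>)
      then show ?thesis unfolding g_def Nh Ph by simp
    qed
    have gx: "g (x i) = 0"
      using Nh[of "x i"] Ph[of "x i"] Nx unfolding g_def c_def by simp
    have "(g has_real_derivative (c * (real r * x i ^ (r - 1)) - P1)) (at (x i))"
      unfolding g_def by (auto intro!: derivative_eq_intros)
    then have "c * (real r * x i ^ (r - 1)) - P1 = 0"
    proof (rule DERIV_local_min[OF _ xpos[OF i]])
      show "\<forall>y. \<bar>x i - y\<bar> < x i \<longrightarrow> g (x i) \<le> g y" using g0 gx by auto
    qed
    then have "c * r * x i ^ r = x i * P1"
      using r by (cases r) (auto simp: algebra_simps)
    also have "\<dots> = (\<Sum>e\<in>{e\<in>E. i \<in> e}. \<Prod>j\<in>e. x j)"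
      unfolding P1_def sum_distrib_left by (intro sum.cong) (auto simp: prod.remove[of _ i] edgeD(3))
    finally show ?thesis .
  qed
  then have "positive_eigenvector r V E (c * r) x"
    unfolding positive_eigenvector_def using xpos by simp
  moreover have "c * r > 0" using cpos r by simp
  ultimately show ?thesis by blast
qed

section \<open>The linear system on the path\<close>

text \<open>\<open>\<zeta>\<close> is the value at the vertex \<open>w\<close>, joined to \<open>v_k\<close>; the terms \<open>z m / s\<close> are the values at the
  leaves attached to \<open>v_2\<close> and \<open>v_5\<close>, eliminated by their own equations.\<close>

definition spine_eq :: "real \<Rightarrow> nat \<Rightarrow> real \<Rightarrow> (nat \<Rightarrow> real) \<Rightarrow> bool" where
  "spine_eq s k \<zeta> z \<longleftrightarrow> (\<forall>m\<in>{1..9}. z m > 0 \<and>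
     s * z m = (if m = 1 then 0 else z (m - 1)) + (if m = 9 then 0 else z (m + 1))
             + (if m \<in> {2, 5} then z m / s else 0) + (if m = k then \<zeta> else 0))"

lemma atLeast1_atMost9: "{1..9::nat} = {1, 2, 3, 4, 5, 6, 7, 8, 9}"
  by auto

lemma atLeast1_atMost8: "{1..8::nat} = {1, 2, 3, 4, 5, 6, 7, 8}"
  by auto

text \<open>Solving inwards from both ends of the path expresses every entry through
  \<open>a = z 1\<close> or \<open>b = z 9\<close>, and the equation at \<open>v_4\<close> ties
  \<open>a\<close> to \<open>b\<close>. Under this relation the branch values of the second system
  fit the same \<open>\<zeta>\<close> and the same value at the attachment vertex.\<close>

lemma spine_eq_transfer:
  assumes s: "s > 0" and z: "spine_eq s 3 \<zeta> z"
  shows "\<exists>z'. spine_eq s 6 \<zeta> z' \<and> z' 6 = z 3"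
proof -
  have pos: "z 1 > 0" "z 2 > 0" "z 3 > 0" "z 4 > 0" "z 5 > 0" "z 6 > 0" "z 7 > 0" "z 8 > 0" "z 9 > 0"
    and e: "s * z 1 = z 2" "s * z 2 = z 1 + z 3 + z 2 / s" "s * z 3 = z 2 + z 4 + \<zeta>"
      "s * z 4 = z 3 + z 5" "s * z 5 = z 4 + z 6 + z 5 / s" "s * z 6 = z 5 + z 7"
      "s * z 7 = z 6 + z 8" "s * z 8 = z 7 + z 9" "s * z 9 = z 8"
    using z unfolding spine_eq_def atLeast1_atMost9 by (simp_all add: numeral_2_eq_2[symmetric])
  define a where "a = z 1"
  define b where "b = z 9"
  have z2: "z 2 = s * a" using e(1) a_def by simp
  have z3: "z 3 = (s^2 - 2) * a" using e(2) s unfolding z2 a_def by (simp add: field_simps power2_eq_square)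
  have z8: "z 8 = s * b" using e(9) b_def by simp
  have z7: "z 7 = (s^2 - 1) * b" using e(8) unfolding z8 b_def by (simp add: algebra_simps power2_eq_square)
  have z6: "z 6 = (s^3 - 2 * s) * b" using e(7) unfolding z7 z8 by (simp add: algebra_simps power2_eq_square power3_eq_cube)
  have z5: "z 5 = (s^4 - 3 * s^2 + 1) * b" using e(6) unfolding z7 z6 by (simp add: algebra_simps eval_nat_numeral)
  \<comment> \<open>The leaf term \<open>z 5 / s\<close> makes \<open>z 4\<close> a rational
    function of \<open>s\<close>; the multiple \<open>s * z 4\<close> stays polynomial.\<close>
  have sz4: "s * z 4 = (s^6 - 5 * s^4 + 6 * s^2 - 1) * b"
    using e(5) s unfolding z5 z6 by (simp add: field_simps eval_nat_numeral)
  have "z 3 = (s^6 - 6 * s^4 + 9 * s^2 - 2) * b"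
    using e(4) sz4 unfolding z5 by (simp add: algebra_simps)
  also have "\<dots> = (s^2 - 2) * ((s^4 - 4 * s^2 + 1) * b)"
    by (simp add: algebra_simps eval_nat_numeral)
  finally have ab': "(s^2 - 2) * a = (s^2 - 2) * ((s^4 - 4 * s^2 + 1) * b)" unfolding z3 .
  have a: "a > 0" and b: "b > 0" using pos a_def b_def by simp_all
  \<comment> \<open>Positivity of \<open>z 3\<close> excludes \<open>s^2 = 2\<close>, so the common
    factor in \<open>ab'\<close> may be cancelled.\<close>
  have s2: "s^2 > 2" using pos(3) a unfolding z3 by (simp add: zero_less_mult_iff)
  have ab: "a = (s^4 - 4 * s^2 + 1) * b" using ab' s2 by simp
  have "s^4 - 4 * s^2 + 1 > 0" using a b unfolding ab by (simp add: zero_less_mult_iff)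
  then have q: "s^2 * (s^2 - 4) + 1 > 0" by (simp add: algebra_simps eval_nat_numeral)
  \<comment> \<open>This sharper bound is what makes \<open>z' 4\<close> below positive. It follows
    from \<open>a / b > 0\<close> together with \<open>s^2 > 2\<close>.\<close>
  have s3: "s^2 > 3"
  proof (rule ccontr)
    assume "\<not> s^2 > 3"
    then have "s^2 * (s^2 - 4) \<le> s^2 * (-1)" by (intro mult_left_mono) auto
    then show False using q s2 by linarith
  qed
  \<comment> \<open>Found by solving each of the two branches at \<open>v_6\<close> from its leaves inwards and scaling it to
    take the value \<open>z 3\<close> at \<open>v_6\<close>.\<close>
  define z' where "z' = (\<lambda>m::nat. 0::real)(1 := s * b, 2 := s^2 * b, 3 := (s^2 - 2) * s * b,
     4 := (s^2 - 3) * s^2 * b, 5 := s * (a + b), 6 := z 3, 7 := (s - 1 / s) * a, 8 := a, 9 := a / s)"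
  have sab: "s * (a + b) = (s^5 - 4 * s^3 + 2 * s) * b"
    unfolding ab by (simp add: algebra_simps eval_nat_numeral)
  have zeta: "\<zeta> = s * z 3 - s * a - z 4" using e(3) z2 by simp
  have "s - 1 / s > 0" using s s2 by (simp add: field_simps power2_eq_square)
  then have "z' m > 0" if "m \<in> {1..9}" for m
    using that s s2 s3 a b pos(3) unfolding atLeast1_atMost9 z'_def by auto
  moreover have "s * z' 1 = z' 2" "s * z' 2 = z' 1 + z' 3 + z' 2 / s" "s * z' 3 = z' 2 + z' 4"
      "s * z' 7 = z' 6 + z' 8" "s * z' 8 = z' 7 + z' 9" "s * z' 9 = z' 8"
    using s unfolding z'_def by (simp_all add: z3) (simp_all add: field_simps eval_nat_numeral)
  moreover have "s * z' 4 = z' 3 + z' 5"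
    unfolding z'_def by (simp add: sab) (simp add: algebra_simps eval_nat_numeral)
  moreover have "s * z' 5 = z' 4 + z' 6 + z' 5 / s"
    using s unfolding z'_def by (simp add: z3 ab) (simp add: field_simps eval_nat_numeral)
  moreover have "s * z' 6 = z' 5 + z' 7 + \<zeta>"
  proof -
    \<comment> \<open>After inserting \<open>\<zeta>\<close>, the terms \<open>s * z 3\<close>
      cancel and the equation at \<open>v_6\<close> reads \<open>z 4 = z' 5 + z' 7 - s * a\<close>.
      It is checked after multiplication by \<open>s\<close>, where \<open>sz4\<close>
      applies.\<close>
    have "s * (s * (a + b) + (s - 1 / s) * a - s * a) = s * z 4"
      unfolding sz4 ab using s by (simp add: field_simps eval_nat_numeral)
    then show ?thesis using s unfolding z'_def zeta by simp
  qed
  ultimately have "spine_eq s 6 \<zeta> z'"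
    unfolding spine_eq_def atLeast1_atMost9 by (simp add: numeral_2_eq_2[symmetric])
  moreover have "z' 6 = z 3" unfolding z'_def by simp
  ultimately show ?thesis by blast
qed

section \<open>The path linked to an arbitrary hypergraph\<close>

text \<open>The common part of the two hypergraphs \<open>R\<close>: what is left of either one when
  the pendent edge used for gluing is removed.\<close>

definition spine_edges :: "nat \<Rightarrow> rvert set set" where
  "spine_edges r = path_edge r ` {1..8} \<union> pend_edge r ` {2, 5}"

section \<open>Membership, size and distinctness of path and pendent edges\<close>

lemma path_edge_eq: "path_edge r i = insert (PV i) (insert (PV (Suc i)) (IV i ` {1..r - 2}))"
  unfolding path_edge_def by auto

lemma pend_edge_eq: "pend_edge r k = insert (PV k) (NV k ` {1..r - 1})"
  unfolding pend_edge_def by auto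

lemma PV_in_path_edge [simp]: "PV m \<in> path_edge r i \<longleftrightarrow> m = i \<or> m = Suc i"
  and IV_in_path_edge [simp]: "IV i' l \<in> path_edge r i \<longleftrightarrow> i' = i \<and> l \<in> {1..r - 2}"
  and NV_in_path_edge [simp]: "NV k l \<notin> path_edge r i"
  and PV_in_pend_edge [simp]: "PV m \<in> pend_edge r k \<longleftrightarrow> m = k"
  and IV_in_pend_edge [simp]: "IV i l \<notin> pend_edge r k"
  and NV_in_pend_edge [simp]: "NV k' l \<in> pend_edge r k \<longleftrightarrow> k' = k \<and> l \<in> {1..r - 1}"
  by (auto simp: path_edge_eq pend_edge_eq)

lemma finite_path_edge [simp]: "finite (path_edge r i)"
  and finite_pend_edge [simp]: "finite (pend_edge r k)"
  by (simp_all add: path_edge_eq pend_edge_eq)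

lemma card_path_edge: "r \<ge> 2 \<Longrightarrow> card (path_edge r i) = r"
  unfolding path_edge_eq by (subst card_insert_disjoint; auto simp: card_image inj_on_def)+

lemma card_pend_edge: "r \<ge> 1 \<Longrightarrow> card (pend_edge r k) = r"
  unfolding pend_edge_eq by (subst card_insert_disjoint; auto simp: card_image inj_on_def)

lemma path_edge_inject [simp]: "path_edge r i = path_edge r i' \<longleftrightarrow> i = i'"
proof
  assume "path_edge r i = path_edge r i'"
  then have "PV i \<in> path_edge r i'" "PV (Suc i) \<in> path_edge r i'"
    by (metis PV_in_path_edge)+
  then show "i = i'" by auto
qed simp

lemma pend_edge_inject [simp]: "pend_edge r k = pend_edge r k' \<longleftrightarrow> k = k'"
  by (metis PV_in_pend_edge)

lemma path_edge_neq_pend_edge [simp]: "path_edge r i \<noteq> pend_edge r k" "pend_edge r k \<noteq> path_edge r i"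
  by (metis PV_in_path_edge PV_in_pend_edge n_not_Suc_n)+

lemma PV_in_spine: "PV m \<in> \<Union> (spine_edges r) \<longleftrightarrow> m \<in> {1..9}"
  unfolding spine_edges_def atLeast1_atMost8 atLeast1_atMost9 by auto

lemma IV_in_spine: "IV i l \<in> \<Union> (spine_edges r) \<longleftrightarrow> i \<in> {1..8} \<and> l \<in> {1..r - 2}"
  unfolding spine_edges_def by auto

lemma NV_in_spine: "NV k l \<in> \<Union> (spine_edges r) \<longleftrightarrow> k \<in> {2, 5} \<and> l \<in> {1..r - 1}"
  unfolding spine_edges_def by auto

text \<open>Treats both coalescences at once: \<open>k\<close> is the index of the attachment vertex
  and \<open>NV k j\<close> is the pendent vertex identified with \<open>w\<close>. The glued
  pendent edge then becomes \<open>link\<close>.\<close>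

locale linked_spine =
  fixes r k j :: nat and VG :: "'a set" and EG :: "'a set set" and w :: 'a
  assumes r: "r \<ge> 3" and k: "k \<in> {3, 6}" and j: "j \<in> {1..r - 1}"
    and unifG: "uniform_hg r VG EG" and w: "w \<in> VG"
begin

definition link :: "(rvert + 'a) set" where
  "link = insert (Inr w) (Inl ` insert (PV k) (NV k ` ({1..r - 1} - {j})))"

definition edges :: "(rvert + 'a) set set" where
  "edges = insert link (image Inl ` spine_edges r \<union> image Inr ` EG)"

definition verts :: "(rvert + 'a) set" where
  "verts = Inl ` \<Union> (spine_edges r) \<union> Inr ` VG \<union> link"

lemma glue_pend_edge: "glue_map (NV k j) w ` pend_edge r k = link"
proof -
  have "pend_edge r k = insert (NV k j) (insert (PV k) (NV k ` ({1..r - 1} - {j})))"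
    using j unfolding pend_edge_eq by auto
  then show ?thesis
    unfolding link_def by (auto simp: glue_map_def image_iff)
qed

lemma glue_spine: "e \<in> spine_edges r \<Longrightarrow> glue_map (NV k j) w ` e = Inl ` e"
  using k unfolding spine_edges_def by (intro image_cong) (auto simp: glue_map_def)

lemma coal_edges_eq:
  assumes "ER = insert (pend_edge r k) (spine_edges r)"
  shows "coal_edges ER (NV k j) EG w = edges"
  unfolding coal_edges_def edges_def assms
  by (simp add: glue_pend_edge glue_spine cong: image_cong)

lemma coal_verts_eq:
  assumes "ER = insert (pend_edge r k) (spine_edges r)"
  shows "coal_verts (\<Union> ER) (NV k j) VG w = verts"
proof -
  have "glue_map (NV k j) w ` \<Union> (spine_edges r) = Inl ` \<Union> (spine_edges r)"
    unfolding image_Union by (rule arg_cong[where f = Union], rule image_cong[OF refl], rule glue_spine)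
  then show ?thesis
    unfolding coal_verts_def verts_def assms Union_insert image_Un glue_pend_edge by (simp add: Un_ac)
qed

lemma Inl_PV_in_link [simp]: "Inl (PV m) \<in> link \<longleftrightarrow> m = k"
  and Inl_IV_in_link [simp]: "Inl (IV i l) \<notin> link"
  and Inl_NV_in_link [simp]: "Inl (NV k' l) \<in> link \<longleftrightarrow> k' = k \<and> l \<in> {1..r - 1} - {j}"
  and Inr_in_link [simp]: "Inr g \<in> link \<longleftrightarrow> g = w"
  unfolding link_def by auto

lemma card_link: "card link = r"
proof -
  have "card (NV k ` ({1..r - 1} - {j})) = r - 2"
    using j r by (simp add: card_image inj_on_def)
  moreover have "PV k \<notin> NV k ` ({1..r - 1} - {j})" by auto
  ultimately have "card (insert (PV k) (NV k ` ({1..r - 1} - {j}))) = r - 1" using r by simp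
  then have "card (Inl ` insert (PV k) (NV k ` ({1..r - 1} - {j})) :: (rvert + 'a) set) = r - 1"
    by (simp add: card_image[OF inj_Inl] del: image_insert)
  then show ?thesis unfolding link_def using r by (subst card_insert_disjoint) auto
qed

lemma link_neq: "link \<noteq> Inl ` e" "link \<noteq> Inr ` f"
  unfolding link_def by auto

lemma finite_spine_edges: "finite (spine_edges r)"
  unfolding spine_edges_def by simp

lemma uniform: "uniform_hg r verts edges"
proof -
  have "finite verts"
    using unifG unfolding verts_def uniform_hg_def spine_edges_def link_def by auto
  moreover have "e \<subseteq> verts \<and> card e = r" if e: "e \<in> edges" for e
  proof -
    consider "e = link" | f where "f \<in> spine_edges r" "e = Inl ` f" | f where "f \<in> EG" "e = Inr ` f"
      using e[unfolded edges_def] by (elim insertE UnE imageE) metis+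
    then show ?thesis
    proof cases
      case 1
      then show ?thesis using card_link unfolding verts_def by simp
    next
      case 2
      then have "card f = r" using r unfolding spine_edges_def by (auto simp: card_path_edge card_pend_edge)
      then show ?thesis using 2 unfolding verts_def by (auto simp: card_image)
    next
      case 3
      then have "f \<subseteq> VG" "card f = r" using uniform_hg_edgeD[OF unifG] by blast+
      then show ?thesis using 3 unfolding verts_def by (auto simp: card_image)
    qed
  qed
  ultimately show ?thesis unfolding uniform_hg_def by blast
qed

section \<open>Vertices, incident sums and edge products of the linked hypergraph\<close>

lemma Inl_in_verts: "Inl v \<in> verts \<longleftrightarrow> v \<in> \<Union> (spine_edges r) \<or> Inl v \<in> link"
  by (auto simp: verts_def)

lemma PV_in_verts: "Inl (PV m) \<in> verts \<longleftrightarrow> m \<in> {1..9}"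
  using k unfolding Inl_in_verts PV_in_spine by auto

lemma IV_in_verts: "Inl (IV i l) \<in> verts \<longleftrightarrow> i \<in> {1..8} \<and> l \<in> {1..r - 2}"
  unfolding Inl_in_verts IV_in_spine by simp

lemma NV_in_verts:
  "Inl (NV k' l) \<in> verts \<longleftrightarrow> k' \<in> {2, 5} \<and> l \<in> {1..r - 1} \<or> k' = k \<and> l \<in> {1..r - 1} - {j}"
  unfolding Inl_in_verts NV_in_spine by simp

lemma Inr_in_verts: "Inr g \<in> verts \<longleftrightarrow> g \<in> VG"
  using w by (auto simp: verts_def)

text \<open>The four kinds of edges are pairwise distinct as sets, so the sum splits. The
  conditional form lets each kind of vertex be evaluated separately in the lemmas
  \<open>incident_PV\<close> to \<open>incident_Inr\<close>.\<close>

lemma sum_incident: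
  fixes f :: "(rvert + 'a) set \<Rightarrow> real"
  shows "(\<Sum>e\<in>{e\<in>edges. a \<in> e}. f e)
    = (\<Sum>i\<in>{1..8}. if a \<in> Inl ` path_edge r i then f (Inl ` path_edge r i) else 0)
    + (\<Sum>k'\<in>{2, 5}. if a \<in> Inl ` pend_edge r k' then f (Inl ` pend_edge r k') else 0)
    + (if a \<in> link then f link else 0)
    + (\<Sum>e\<in>EG. if a \<in> Inr ` e then f (Inr ` e) else 0)"
proof -
  define g where "g e = (if a \<in> e then f e else 0)" for e
  have fG: "finite EG" by (rule uniform_hg_finite_edges[OF unifG])
  have fin: "finite edges" unfolding edges_def using fG finite_spine_edges by simp
  have disj: "image Inl ` spine_edges r \<inter> (image Inr ` EG :: (rvert + 'a) set set) = {}"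
  proof -
    have "(Inl ` e :: (rvert + 'a) set) \<noteq> Inr ` f" if "e \<in> spine_edges r" for e f
      using that unfolding spine_edges_def path_edge_eq pend_edge_eq by auto
    then show ?thesis by blast
  qed
  have "(\<Sum>e\<in>{e\<in>edges. a \<in> e}. f e) = (\<Sum>e\<in>edges. g e)"
    unfolding g_def using fin by (simp add: sum.inter_filter)
  also have "\<dots> = g link + (\<Sum>e\<in>image Inl ` spine_edges r \<union> image Inr ` EG. g e)"
    unfolding edges_def using fG finite_spine_edges link_neq
    by (subst sum.insert) auto
  also have "(\<Sum>e\<in>image Inl ` spine_edges r \<union> image Inr ` EG. g e)
      = (\<Sum>e\<in>spine_edges r. g (Inl ` e)) + (\<Sum>e\<in>EG. g (Inr ` e))"
    using fG finite_spine_edges disj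
    by (subst sum.union_disjoint) (auto simp: sum.reindex inj_on_def inj_image_eq_iff)
  also have "(\<Sum>e\<in>spine_edges r. g (Inl ` e))
      = (\<Sum>i\<in>{1..8}. g (Inl ` path_edge r i)) + (\<Sum>k'\<in>{2, 5}. g (Inl ` pend_edge r k'))"
    unfolding spine_edges_def
    by (subst sum.union_disjoint) (auto simp: sum.reindex inj_on_def)
  finally show ?thesis unfolding g_def by simp
qed

lemma prod_path_edge:
  "(\<Prod>a\<in>Inl ` path_edge r i. x a) = x (Inl (PV i)) * x (Inl (PV (Suc i))) * (\<Prod>l\<in>{1..r - 2}. x (Inl (IV i l)))"
  for x :: "rvert + 'a \<Rightarrow> real"
  unfolding path_edge_eq by (simp add: prod.reindex inj_on_def image_iff)

lemma prod_pend_edge: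
  "(\<Prod>a\<in>Inl ` pend_edge r k'. x a) = x (Inl (PV k')) * (\<Prod>l\<in>{1..r - 1}. x (Inl (NV k' l)))"
  for x :: "rvert + 'a \<Rightarrow> real"
  unfolding pend_edge_eq by (simp add: prod.reindex inj_on_def image_iff)

lemma prod_link:
  "(\<Prod>a\<in>link. x a) = x (Inl (PV k)) * x (Inr w) * (\<Prod>l\<in>{1..r - 1} - {j}. x (Inl (NV k l)))"
  for x :: "rvert + 'a \<Rightarrow> real"
  unfolding link_def by (simp add: prod.reindex inj_on_def image_iff)

lemma card_inner: "card ({1..r - 1} - {j}) = r - 2"
  using j r by simp

lemma incident_PV:
  fixes f :: "(rvert + 'a) set \<Rightarrow> real"
  assumes "m \<in> {1..9}"
  shows "(\<Sum>e\<in>{e\<in>edges. Inl (PV m) \<in> e}. f e)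
    = (if m = 1 then 0 else f (Inl ` path_edge r (m - 1))) + (if m = 9 then 0 else f (Inl ` path_edge r m))
    + (if m \<in> {2, 5} then f (Inl ` pend_edge r m) else 0) + (if m = k then f link else 0)"
  using assms unfolding sum_incident atLeast1_atMost8 atLeast1_atMost9
  by (elim insertE) (auto simp: image_iff)

lemma incident_IV:
  fixes f :: "(rvert + 'a) set \<Rightarrow> real"
  assumes "i \<in> {1..8}" "l \<in> {1..r - 2}"
  shows "(\<Sum>e\<in>{e\<in>edges. Inl (IV i l) \<in> e}. f e) = f (Inl ` path_edge r i)"
proof -
  have "(\<Sum>i'\<in>{1..8}. if Inl (IV i l) \<in> Inl ` path_edge r i' then f (Inl ` path_edge r i') else 0)
      = (\<Sum>i'\<in>{1..8}. if i' = i then f (Inl ` path_edge r i') else 0)"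
    using assms(2) by (intro sum.cong) (auto simp: image_iff)
  then show ?thesis using assms(1) unfolding sum_incident by (simp add: image_iff)
qed

lemma incident_NV:
  fixes f :: "(rvert + 'a) set \<Rightarrow> real"
  assumes "k' \<in> {2, 5}" "l \<in> {1..r - 1}"
  shows "(\<Sum>e\<in>{e\<in>edges. Inl (NV k' l) \<in> e}. f e) = f (Inl ` pend_edge r k')"
  using assms k unfolding sum_incident by (auto simp: image_iff)

lemma incident_link:
  fixes f :: "(rvert + 'a) set \<Rightarrow> real"
  assumes "l \<in> {1..r - 1} - {j}"
  shows "(\<Sum>e\<in>{e\<in>edges. Inl (NV k l) \<in> e}. f e) = f link"
  using assms k unfolding sum_incident by (auto simp: image_iff)

lemma incident_Inr:
  fixes f :: "(rvert + 'a) set \<Rightarrow> real"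
  shows "(\<Sum>e\<in>{e\<in>edges. Inr g \<in> e}. f e)
    = (\<Sum>e\<in>{e\<in>EG. g \<in> e}. f (Inr ` e)) + (if g = w then f link else 0)"
  unfolding sum_incident using uniform_hg_finite_edges[OF unifG]
  by (auto simp: image_iff sum.inter_filter)

text \<open>In a path edge, a pendent edge or \<open>link\<close>, the equation at a vertex of
  degree 1 gives \<open>x ^ r = q\<close> with \<open>q\<close> the edge product over
  \<open>lam\<close>. Taking the \<open>r\<close>-th power of the edge product and cancelling a
  power of \<open>q\<close> determines \<open>q\<close> from the remaining vertices. What \<Gamma>
  sees of the path is a single extra term at \<open>w\<close>, recorded in the second
  conclusion.\<close>

lemma eigenvector_imp_spine_eq:
  assumes lam: "lam > 0" and x: "positive_eigenvector r verts edges lam x"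
  defines "s \<equiv> sqrt (lam ^ r)" and "\<zeta> \<equiv> sqrt (x (Inr w) ^ r)" and "z \<equiv> \<lambda>m. sqrt (x (Inl (PV m)) ^ r)"
  shows "spine_eq s k \<zeta> z"
    and "\<forall>g\<in>VG. x (Inr g) > 0 \<and> lam * x (Inr g) ^ r
      = (\<Sum>e\<in>{e\<in>EG. g \<in> e}. \<Prod>h\<in>e. x (Inr h)) + (if g = w then lam * (z k * \<zeta> / s) else 0)"
proof -
  have pos: "x a > 0" if "a \<in> verts" for a
    using x that unfolding positive_eigenvector_def by blast
  have eq: "lam * x a ^ r = (\<Sum>e\<in>{e\<in>edges. a \<in> e}. \<Prod>b\<in>e. x b)" if "a \<in> verts" for a
    using x that unfolding positive_eigenvector_def by blast
  have s: "s > 0" "s^2 = lam ^ r" using lam unfolding s_def by auto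
  have xw: "x (Inr w) > 0" using pos w Inr_in_verts by blast
  have \<zeta>: "\<zeta> > 0" "\<zeta>^2 = x (Inr w) ^ r" using xw unfolding \<zeta>_def by auto
  have xPV: "x (Inl (PV m)) > 0" if "m \<in> {1..9}" for m using that pos PV_in_verts by blast
  have z: "z m > 0" "(z m)^2 = x (Inl (PV m)) ^ r" if "m \<in> {1..9}" for m
    using xPV[OF that] unfolding z_def by auto
  define X where "X e = (\<Prod>b\<in>e. x b)" for e
  have X_path: "X (Inl ` path_edge r i) = lam * (z i * z (i + 1) / s)" if i: "i \<in> {1..8}" for i
  proof -
    define q where "q = X (Inl ` path_edge r i) / lam"
    have i1: "i \<in> {1..9}" "i + 1 \<in> {1..9}" using i by auto
    have inner: "x (Inl (IV i l)) > 0" "x (Inl (IV i l)) ^ r = q" if l: "l \<in> {1..r - 2}" for l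
      using eq[of "Inl (IV i l)"] incident_IV[OF i l] pos[of "Inl (IV i l)"] i l lam
      unfolding q_def X_def by (simp_all add: IV_in_verts field_simps)
    have "X (Inl ` path_edge r i) > 0"
      unfolding X_def prod_path_edge using inner xPV[OF i1(1)] xPV[OF i1(2)]
      by (intro mult_pos_pos prod_pos) auto
    then have q: "q > 0" using lam unfolding q_def by simp
    \<comment> \<open>Two spine vertices and \<open>r - 2\<close> equal inner entries. With
      \<open>s^2 = lam ^ r\<close>, cancelling \<open>q ^ (r - 2)\<close> leaves a relation between
      squares of positive numbers.\<close>
    have "X (Inl ` path_edge r i) ^ r = (z i)^2 * (z (i + 1))^2 * (\<Prod>l\<in>{1..r - 2}. x (Inl (IV i l)) ^ r)"
      unfolding X_def prod_path_edge z(2)[OF i1(1)] z(2)[OF i1(2)] by (simp add: power_mult_distrib prod_power_distrib)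
    also have "(\<Prod>l\<in>{1..r - 2}. x (Inl (IV i l)) ^ r) = q ^ (r - 2)"
      using inner by simp
    finally have "(lam * q) ^ r = (z i * z (i + 1))^2 * q ^ (r - 2)"
      using lam unfolding q_def by (simp add: power_mult_distrib)
    moreover have "(lam * q) ^ r = (s * q)^2 * q ^ (r - 2)"
    proof -
      have "q ^ r = q^2 * q ^ (r - 2)" using r by (metis le_add_diff_inverse numeral_2_eq_2 numeral_3_eq_3 Suc_leD power_add)
      then show ?thesis by (simp add: power_mult_distrib s)
    qed
    ultimately have "(s * q)^2 * q ^ (r - 2) = (z i * z (i + 1))^2 * q ^ (r - 2)" by metis
    then have "(s * q)^2 = (z i * z (i + 1))^2"
      by (rule iffD1[OF mult_right_cancel, rotated]) (use q in simp)
    then have "s * q = z i * z (i + 1)"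
      by (rule power2_eq_imp_eq[OF _ less_imp_le[OF mult_pos_pos[OF s(1) q]]
            less_imp_le[OF mult_pos_pos[OF z(1)[OF i1(1)] z(1)[OF i1(2)]]]])
    then have "q = z i * z (i + 1) / s" using s by (simp add: field_simps)
    then show ?thesis using lam unfolding q_def by (simp add: field_simps)
  qed
  have X_pend: "X (Inl ` pend_edge r k') = lam * ((z k')^2 / s^2)" if k': "k' \<in> {2, 5}" for k'
  proof -
    define q where "q = X (Inl ` pend_edge r k') / lam"
    have k9: "k' \<in> {1..9}" using k' by auto
    have inner: "x (Inl (NV k' l)) > 0" "x (Inl (NV k' l)) ^ r = q" if l: "l \<in> {1..r - 1}" for l
      using eq[of "Inl (NV k' l)"] incident_NV[OF k' l] pos[of "Inl (NV k' l)"] k' l lam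
      unfolding q_def X_def by (auto simp: NV_in_verts field_simps)
    have "X (Inl ` pend_edge r k') > 0"
      unfolding X_def prod_pend_edge using inner xPV[OF k9] by (intro mult_pos_pos prod_pos) auto
    then have q: "q > 0" using lam unfolding q_def by simp
    \<comment> \<open>Here only one spine vertex remains, against \<open>r - 1\<close> equal
      entries, so \<open>s^2 * q\<close> equals a single square and no root is taken.\<close>
    have "X (Inl ` pend_edge r k') ^ r = (z k')^2 * (\<Prod>l\<in>{1..r - 1}. x (Inl (NV k' l)) ^ r)"
      unfolding X_def prod_pend_edge z(2)[OF k9] by (simp add: power_mult_distrib prod_power_distrib)
    also have "(\<Prod>l\<in>{1..r - 1}. x (Inl (NV k' l)) ^ r) = q ^ (r - 1)"
      using inner by simp
    finally have "(lam * q) ^ r = (z k')^2 * q ^ (r - 1)"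
      using lam unfolding q_def by (simp add: power_mult_distrib)
    moreover have "(lam * q) ^ r = (s^2 * q) * q ^ (r - 1)"
    proof -
      have "q ^ r = q * q ^ (r - 1)" using r by (simp add: power_Suc[symmetric])
      then show ?thesis by (simp add: power_mult_distrib s)
    qed
    ultimately have "(s^2 * q) * q ^ (r - 1) = (z k')^2 * q ^ (r - 1)" by metis
    then have "s^2 * q = (z k')^2"
      by (rule iffD1[OF mult_right_cancel, rotated]) (use q in simp)
    then have "q = (z k')^2 / s^2" using s(1) by (simp add: field_simps)
    then show ?thesis using lam unfolding q_def by (simp add: field_simps)
  qed
  have X_link: "X link = lam * (z k * \<zeta> / s)"
  proof -
    define q where "q = X link / lam"
    have k9: "k \<in> {1..9}" using k by auto
    have inner: "x (Inl (NV k l)) > 0" "x (Inl (NV k l)) ^ r = q" if l: "l \<in> {1..r - 1} - {j}" for l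
      using eq[of "Inl (NV k l)"] incident_link[OF l] pos[of "Inl (NV k l)"] l lam
      unfolding q_def X_def by (auto simp: NV_in_verts field_simps)
    have "X link > 0"
      unfolding X_def prod_link using inner xPV[OF k9] xw by (intro mult_pos_pos prod_pos) auto
    then have q: "q > 0" using lam unfolding q_def by simp
    \<comment> \<open>As for a path edge, with \<open>w\<close> in the place of the second spine
      vertex.\<close>
    have "X link ^ r = (z k)^2 * \<zeta>^2 * (\<Prod>l\<in>{1..r - 1} - {j}. x (Inl (NV k l)) ^ r)"
      unfolding X_def prod_link z(2)[OF k9] \<zeta>(2) by (simp add: power_mult_distrib prod_power_distrib)
    also have "(\<Prod>l\<in>{1..r - 1} - {j}. x (Inl (NV k l)) ^ r) = q ^ (r - 2)"
      using inner by (simp add: card_inner[simplified])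
    finally have "(lam * q) ^ r = (z k * \<zeta>)^2 * q ^ (r - 2)"
      using lam unfolding q_def by (simp add: power_mult_distrib)
    moreover have "(lam * q) ^ r = (s * q)^2 * q ^ (r - 2)"
    proof -
      have "q ^ r = q^2 * q ^ (r - 2)" using r by (metis le_add_diff_inverse numeral_2_eq_2 numeral_3_eq_3 Suc_leD power_add)
      then show ?thesis by (simp add: power_mult_distrib s)
    qed
    ultimately have "(s * q)^2 * q ^ (r - 2) = (z k * \<zeta>)^2 * q ^ (r - 2)" by metis
    then have "(s * q)^2 = (z k * \<zeta>)^2"
      by (rule iffD1[OF mult_right_cancel, rotated]) (use q in simp)
    then have "s * q = z k * \<zeta>"
      by (rule power2_eq_imp_eq[OF _ less_imp_le[OF mult_pos_pos[OF s(1) q]]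
            less_imp_le[OF mult_pos_pos[OF z(1)[OF k9] \<zeta>(1)]]])
    then have "q = z k * \<zeta> / s" using s by (simp add: field_simps)
    then show ?thesis using lam unfolding q_def by (simp add: field_simps)
  qed
  show "spine_eq s k \<zeta> z"
    unfolding spine_eq_def
  proof (intro ballI conjI)
    fix m :: nat assume m: "m \<in> {1..9}"
    show "z m > 0" by (rule z(1)[OF m])
    have prev: "X (Inl ` path_edge r (m - 1)) = lam * (z (m - 1) * z m / s)" if "m \<noteq> 1"
      using m that X_path[of "m - 1"] by (cases m) auto
    have "lam * (z m)^2 = (if m = 1 then 0 else X (Inl ` path_edge r (m - 1)))
        + (if m = 9 then 0 else X (Inl ` path_edge r m))
        + (if m \<in> {2, 5} then X (Inl ` pend_edge r m) else 0) + (if m = k then X link else 0)"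
      unfolding z(2)[OF m] using eq[of "Inl (PV m)"] m unfolding incident_PV[OF m] X_def
      by (simp only: PV_in_verts)
    also have "\<dots> = (if m = 1 then 0 else lam * (z (m - 1) * z m / s))
        + (if m = 9 then 0 else lam * (z m * z (m + 1) / s))
        + (if m \<in> {2, 5} then lam * ((z m)^2 / s^2) else 0) + (if m = k then lam * (z m * \<zeta> / s) else 0)"
      using m prev X_path[of m] X_pend[of m] X_link by auto
    \<comment> \<open>Every edge product at \<open>v_m\<close> contains \<open>z m\<close>; dividing
      by the common positive factor makes the equation linear.\<close>
    also have "\<dots> = lam * z m / s * ((if m = 1 then 0 else z (m - 1)) + (if m = 9 then 0 else z (m + 1))
             + (if m \<in> {2, 5} then z m / s else 0) + (if m = k then \<zeta> else 0))"
      using s(1) by (simp add: field_simps power2_eq_square)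
    finally have "lam * z m / s * (s * z m) = lam * z m / s * ((if m = 1 then 0 else z (m - 1)) + (if m = 9 then 0 else z (m + 1))
             + (if m \<in> {2, 5} then z m / s else 0) + (if m = k then \<zeta> else 0))"
      using s by (simp add: power2_eq_square)
    then show "s * z m = (if m = 1 then 0 else z (m - 1)) + (if m = 9 then 0 else z (m + 1))
             + (if m \<in> {2, 5} then z m / s else 0) + (if m = k then \<zeta> else 0)"
      using lam z(1)[OF m] s(1) by (subst (asm) mult_cancel_left) simp
  qed
  show "\<forall>g\<in>VG. x (Inr g) > 0 \<and> lam * x (Inr g) ^ r
      = (\<Sum>e\<in>{e\<in>EG. g \<in> e}. \<Prod>h\<in>e. x (Inr h)) + (if g = w then lam * (z k * \<zeta> / s) else 0)"
  proof (intro ballI conjI)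
    fix g assume g: "g \<in> VG"
    then have gv: "Inr g \<in> verts" using Inr_in_verts by blast
    show "x (Inr g) > 0" by (rule pos[OF gv])
    show "lam * x (Inr g) ^ r
      = (\<Sum>e\<in>{e\<in>EG. g \<in> e}. \<Prod>h\<in>e. x (Inr h)) + (if g = w then lam * (z k * \<zeta> / s) else 0)"
      unfolding eq[OF gv] incident_Inr X_link[symmetric] X_def by (simp add: prod.reindex)
  qed
qed

text \<open>Reverses the elimination: the entries at vertices of degree 1 are the
  \<open>r\<close>-th roots of the values \<open>q\<close> found there, and \<Gamma> keeps its
  entries \<open>y\<close>, whose equations already contain the contribution of
  \<open>link\<close>.\<close>

lemma spine_eq_imp_eigenvector:
  assumes lam: "lam > 0" and sys: "spine_eq (sqrt (lam ^ r)) k (sqrt (y w ^ r)) z"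
    and y: "\<forall>g\<in>VG. y g > 0 \<and> lam * y g ^ r = (\<Sum>e\<in>{e\<in>EG. g \<in> e}. \<Prod>h\<in>e. y h)
      + (if g = w then lam * (z k * sqrt (y w ^ r) / sqrt (lam ^ r)) else 0)"
  shows "\<exists>x. positive_eigenvector r verts edges lam x"
proof -
  define s where "s = sqrt (lam ^ r)"
  define \<zeta> where "\<zeta> = sqrt (y w ^ r)"
  have s: "s > 0" "s^2 = lam ^ r" using lam unfolding s_def by auto
  have yw: "y w > 0" using y w by blast
  have \<zeta>: "\<zeta> > 0" "\<zeta>^2 = y w ^ r" using yw unfolding \<zeta>_def by auto
  have z: "z m > 0" if "m \<in> {1..9}" for m using sys that unfolding spine_eq_def by blast
  have zne: "z m \<noteq> 0" if "m \<in> {1..9}" for m using z[OF that] by simp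
  have zeq: "s * z m = (if m = 1 then 0 else z (m - 1)) + (if m = 9 then 0 else z (m + 1))
             + (if m \<in> {2, 5} then z m / s else 0) + (if m = k then \<zeta> else 0)" if "m \<in> {1..9}" for m
    using sys that unfolding spine_eq_def s_def \<zeta>_def by blast
  have k9: "k \<in> {1..9}" and k25: "k \<notin> {2, 5}" using k by auto
  \<comment> \<open>\<open>q v\<close> is the \<open>r\<close>-th power of the entry wanted at
    \<open>v\<close>. Since \<open>k\<close> is neither 2 nor 5, the vertices \<open>NV k l\<close>
    belong to \<open>link\<close> only, so the two cases for \<open>NV\<close> do not clash.\<close>
  define q where "q v = (case v of PV m \<Rightarrow> (z m)^2 | IV i l \<Rightarrow> z i * z (i + 1) / s
      | NV k' l \<Rightarrow> (if k' = k then z k * \<zeta> / s else (z k')^2 / s^2))" for v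
  define x where "x a = (case a of Inl v \<Rightarrow> root r (q v) | Inr g \<Rightarrow> y g)" for a
  define X where "X e = (\<Prod>b\<in>e. x b)" for e
  have q_pos: "q v > 0" if "Inl v \<in> verts" for v
    using that z zne k9 s(1) \<zeta>(1) by (cases v) (auto simp: q_def PV_in_verts IV_in_verts NV_in_verts)
  have x_pos: "x a > 0" if "a \<in> verts" for a
    using that q_pos y r unfolding x_def by (cases a) (auto simp: Inr_in_verts)
  have x_pow: "x (Inl v) ^ r = q v" if "Inl v \<in> verts" for v
    using q_pos[OF that] r unfolding x_def by simp
  \<comment> \<open>A positive edge product is determined by its \<open>r\<close>-th power, which is
    computable because only the powers \<open>q v\<close> of the entries are explicit.\<close>
  have X_val: "X e = lam * p"
    if e: "e \<in> edges" and p: "p > 0" and Xr: "X e ^ r = s^2 * p ^ r" for e p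
  proof -
    have "X e > 0" unfolding X_def by (rule prod_pos) (use x_pos uniform_hg_edgeD(1)[OF uniform e] in blast)
    moreover have "X e ^ r = (lam * p) ^ r" unfolding Xr s by (simp add: power_mult_distrib)
    ultimately show ?thesis using r lam p by (intro power_eq_imp_eq_base[of "X e" r]) auto
  qed
  have sq: "s^2 * p ^ r = (s * p)^2 * p ^ (r - 2)" for p
  proof -
    have "p ^ r = p^2 * p ^ (r - 2)" using r by (metis le_add_diff_inverse numeral_2_eq_2 numeral_3_eq_3 Suc_leD power_add)
    then show ?thesis by (simp add: power_mult_distrib)
  qed
  have X_path: "X (Inl ` path_edge r i) = lam * (z i * z (i + 1) / s)" if i: "i \<in> {1..8}" for i
  proof (rule X_val)
    have i1: "i \<in> {1..9}" "i + 1 \<in> {1..9}" using i by auto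
    show "Inl ` path_edge r i \<in> edges" using i unfolding edges_def spine_edges_def by blast
    show "z i * z (i + 1) / s > 0" using z[OF i1(1)] z[OF i1(2)] s by simp
    have "X (Inl ` path_edge r i) ^ r = x (Inl (PV i)) ^ r * x (Inl (PV (i + 1))) ^ r
        * (\<Prod>l\<in>{1..r - 2}. x (Inl (IV i l)) ^ r)"
      unfolding X_def prod_path_edge by (simp add: power_mult_distrib prod_power_distrib)
    also have "(\<Prod>l\<in>{1..r - 2}. x (Inl (IV i l)) ^ r) = (\<Prod>l\<in>{1..r - 2}. z i * z (i + 1) / s)"
      by (rule prod.cong) (use i in \<open>auto simp: x_pow IV_in_verts q_def\<close>)
    finally show "X (Inl ` path_edge r i) ^ r = s^2 * (z i * z (i + 1) / s) ^ r"
      unfolding sq using s i1 by (simp add: x_pow PV_in_verts q_def power_mult_distrib)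
  qed
  have X_pend: "X (Inl ` pend_edge r k') = lam * ((z k')^2 / s^2)" if k': "k' \<in> {2, 5}" for k'
  proof (rule X_val)
    have k'9: "k' \<in> {1..9}" and k'k: "k' \<noteq> k" using k' k by auto
    show "Inl ` pend_edge r k' \<in> edges" using k' unfolding edges_def spine_edges_def by blast
    show "(z k')^2 / s^2 > 0" using z[OF k'9] s(1) by simp
    have "X (Inl ` pend_edge r k') ^ r = x (Inl (PV k')) ^ r * (\<Prod>l\<in>{1..r - 1}. x (Inl (NV k' l)) ^ r)"
      unfolding X_def prod_pend_edge by (simp add: power_mult_distrib prod_power_distrib)
    also have "(\<Prod>l\<in>{1..r - 1}. x (Inl (NV k' l)) ^ r) = (\<Prod>l\<in>{1..r - 1}. (z k')^2 / s^2)"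
      by (rule prod.cong) (use k' k'k in \<open>auto simp: x_pow NV_in_verts q_def\<close>)
    finally have "X (Inl ` pend_edge r k') ^ r = (z k')^2 * ((z k')^2 / s^2) ^ (r - 1)"
      using k'9 by (simp add: x_pow PV_in_verts q_def)
    also have "\<dots> = s^2 * (((z k')^2 / s^2) * ((z k')^2 / s^2) ^ (r - 1))" using s(1) by simp
    also have "((z k')^2 / s^2) * ((z k')^2 / s^2) ^ (r - 1) = ((z k')^2 / s^2) ^ r"
      using r by (simp only: power_Suc[symmetric]) simp
    finally show "X (Inl ` pend_edge r k') ^ r = s^2 * ((z k')^2 / s^2) ^ r" .
  qed
  have X_link: "X link = lam * (z k * \<zeta> / s)"
  proof (rule X_val)
    show "link \<in> edges" unfolding edges_def by blast
    show "z k * \<zeta> / s > 0" using z[OF k9] s \<zeta> by simp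
    have "X link ^ r = x (Inl (PV k)) ^ r * x (Inr w) ^ r * (\<Prod>l\<in>{1..r - 1} - {j}. x (Inl (NV k l)) ^ r)"
      unfolding X_def prod_link by (simp add: power_mult_distrib prod_power_distrib)
    also have "x (Inr w) ^ r = \<zeta>^2" unfolding \<zeta>(2) by (simp add: x_def)
    also have "(\<Prod>l\<in>{1..r - 1} - {j}. x (Inl (NV k l)) ^ r) = (\<Prod>l\<in>{1..r - 1} - {j}. z k * \<zeta> / s)"
      by (rule prod.cong) (auto simp: x_pow NV_in_verts q_def)
    finally show "X link ^ r = s^2 * (z k * \<zeta> / s) ^ r"
      unfolding sq using s k9 card_inner by (simp add: x_pow PV_in_verts q_def power_mult_distrib)
  qed
  have "lam * x a ^ r = (\<Sum>e\<in>{e\<in>edges. a \<in> e}. X e)" if a: "a \<in> verts" for a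
  proof (cases a)
    case (Inr g)
    then have g: "g \<in> VG" using a Inr_in_verts by blast
    then show ?thesis
      unfolding Inr incident_Inr X_link using y
      by (simp add: X_def prod.reindex x_def s_def \<zeta>_def)
  next
    case (Inl v)
    have xr: "x a ^ r = q v" using x_pow a Inl by blast
    show ?thesis
    proof (cases v)
      case (PV m)
      then have m: "m \<in> {1..9}" using a Inl PV_in_verts by blast
      have prev: "X (Inl ` path_edge r (m - 1)) = lam * (z (m - 1) * z m / s)" if "m \<noteq> 1"
        using m that X_path[of "m - 1"] by (cases m) auto
      have "(\<Sum>e\<in>{e\<in>edges. a \<in> e}. X e) = (if m = 1 then 0 else lam * (z (m - 1) * z m / s))
        + (if m = 9 then 0 else lam * (z m * z (m + 1) / s))
        + (if m \<in> {2, 5} then lam * ((z m)^2 / s^2) else 0) + (if m = k then lam * (z m * \<zeta> / s) else 0)"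
        unfolding Inl PV incident_PV[OF m]
        using m prev X_path[of m] X_pend[of m] X_link by auto
      also have "\<dots> = lam * z m / s * ((if m = 1 then 0 else z (m - 1)) + (if m = 9 then 0 else z (m + 1))
             + (if m \<in> {2, 5} then z m / s else 0) + (if m = k then \<zeta> else 0))"
        using s(1) by (simp add: field_simps power2_eq_square)
      also have "\<dots> = lam * z m / s * (s * z m)" unfolding zeq[OF m] ..
      also have "\<dots> = lam * (z m)^2" using s(1) by (simp add: power2_eq_square)
      finally show ?thesis unfolding xr PV q_def by simp
    next
      case (IV i l)
      then have "i \<in> {1..8}" "l \<in> {1..r - 2}" using a Inl IV_in_verts by blast+
      then show ?thesis unfolding xr unfolding Inl IV by (simp only: incident_IV X_path) (simp add: q_def)
    next
      case (NV k' l)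
      then consider "k' \<in> {2, 5}" "l \<in> {1..r - 1}" | "k' = k" "l \<in> {1..r - 1} - {j}"
        using a Inl NV_in_verts by blast
      then show ?thesis
      proof cases
        case 1
        moreover have "k' \<noteq> k" using 1 k25 by blast
        ultimately show ?thesis
          unfolding xr unfolding Inl NV by (simp only: incident_NV X_pend) (simp add: q_def)
      next
        case 2
        then show ?thesis
          unfolding xr unfolding Inl NV by (simp only: incident_link X_link) (simp add: q_def)
      qed
    qed
  qed
  then have "positive_eigenvector r verts edges lam x"
    unfolding positive_eigenvector_def X_def using x_pos by blast
  then show ?thesis by blast
qed

end

section \<open>Matching numbers\<close>

lemma match_num_0: "finite E \<Longrightarrow> match_num E 0 = 1"
proof -
  assume "finite E"
  then have "matchings E 0 = {{}}"
    unfolding matchings_def by (auto dest: finite_subset)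
  then show ?thesis unfolding match_num_def by simp
qed

text \<open>Matchings are sorted by whether they use \<open>e\<close>; those that do become
  matchings of the edges disjoint from \<open>e\<close>. Nonemptiness keeps \<open>e\<close> itself
  out of that set, so re-inserting it raises the cardinality.\<close>

lemma match_num_Suc:
  assumes fin: "finite E" and e: "e \<in> E" and ne: "e \<noteq> {}"
  shows "match_num E (Suc n) = match_num (E - {e}) (Suc n) + match_num {f\<in>E. f \<inter> e = {}} n"
proof -
  let ?D = "{f\<in>E. f \<inter> e = {}}"
  have finM: "finite (matchings E' m)" if "E' \<subseteq> E" for E' m
    unfolding matchings_def by (rule finite_subset[of _ "Pow E"]) (use that fin in auto)
  have eD: "e \<notin> M" if "M \<in> matchings ?D n" for M
    using that ne unfolding matchings_def by auto
  have eq: "matchings E (Suc n) = matchings (E - {e}) (Suc n) \<union> insert e ` matchings ?D n"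
  proof (intro equalityI subsetI)
    fix M assume M: "M \<in> matchings E (Suc n)"
    show "M \<in> matchings (E - {e}) (Suc n) \<union> insert e ` matchings ?D n"
    proof (cases "e \<in> M")
      case True
      have "finite M" using M fin unfolding matchings_def by (auto dest: finite_subset)
      then have "M - {e} \<in> matchings ?D n"
        using M True unfolding matchings_def by auto
      moreover have "M = insert e (M - {e})" using True by blast
      ultimately show ?thesis by blast
    next
      case False
      then show ?thesis using M unfolding matchings_def by auto
    qed
  next
    fix M assume "M \<in> matchings (E - {e}) (Suc n) \<union> insert e ` matchings ?D n"
    then show "M \<in> matchings E (Suc n)"
    proof
      assume "M \<in> matchings (E - {e}) (Suc n)"
      then show ?thesis unfolding matchings_def by auto
    next
      assume "M \<in> insert e ` matchings ?D n"
      then obtain M' where M': "M' \<in> matchings ?D n" "M = insert e M'" by blast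
      have "finite M'" using M' fin unfolding matchings_def by (auto dest: finite_subset)
      then have "card M = Suc n" using M' eD unfolding matchings_def by auto
      moreover have "M \<subseteq> E" using M' e unfolding matchings_def by auto
      moreover have "f \<inter> g = {}" if "f \<in> M" "g \<in> M" "f \<noteq> g" for f g
        using that M' unfolding matchings_def by blast
      ultimately show ?thesis unfolding matchings_def by blast
    qed
  qed
  have "inj_on (insert e) (matchings ?D n)"
    by (rule inj_onI) (use eD in \<open>metis insert_ident\<close>)
  moreover have "matchings (E - {e}) (Suc n) \<inter> insert e ` matchings ?D n = {}"
    unfolding matchings_def by auto
  ultimately show ?thesis
    unfolding match_num_def eq
    by (subst card_Un_disjoint) (auto simp: finM card_image)
qed

text \<open>Counts matchings as sets of indices, so that two edge families over one index set can be
  compared.\<close>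

lemma match_num_image:
  assumes "inj_on F I"
  shows "match_num (F ` I) n = card {M. M \<subseteq> I \<and> card M = n \<and> (\<forall>x\<in>M. \<forall>y\<in>M. x \<noteq> y \<longrightarrow> F x \<inter> F y = {})}"
    (is "_ = card ?S")
proof -
  have inj: "F x = F y \<longleftrightarrow> x = y" if "M \<subseteq> I" "x \<in> M" "y \<in> M" for M x y
    using that assms by (meson inj_on_eq_iff subsetD)
  have "matchings (F ` I) n = image F ` ?S"
  proof (intro equalityI subsetI)
    fix N assume N: "N \<in> matchings (F ` I) n"
    then obtain M where M: "M \<subseteq> I" "N = F ` M" unfolding matchings_def by (auto simp: subset_image_iff)
    have "card M = n" using N M inj_on_subset[OF assms M(1)] unfolding matchings_def by (auto simp: card_image)
    then have "M \<in> ?S" using N M inj[OF M(1)] unfolding matchings_def by auto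
    then show "N \<in> image F ` ?S" using M by blast
  next
    fix N assume "N \<in> image F ` ?S"
    then obtain M where M: "M \<in> ?S" "N = F ` M" by blast
    have "card N = n" using M inj_on_subset[OF assms, of M] by (auto simp: card_image)
    moreover have "f \<inter> g = {}" if "f \<in> N" "g \<in> N" "f \<noteq> g" for f g
    proof -
      obtain x y where xy: "x \<in> M" "y \<in> M" "f = F x" "g = F y" using \<open>f \<in> N\<close> \<open>g \<in> N\<close> M(2) by auto
      then have "x \<noteq> y" using \<open>f \<noteq> g\<close> by auto
      then show ?thesis using M(1) xy by simp
    qed
    moreover have "N \<subseteq> F ` I" using M by auto
    ultimately show "N \<in> matchings (F ` I) n" unfolding matchings_def by simp
  qed
  moreover have "inj_on (image F) ?S"
    using inj_on_image_Pow[OF assms] by (rule inj_on_subset) auto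
  ultimately show ?thesis unfolding match_num_def by (simp add: card_image)
qed

text \<open>Matching numbers depend only on which pairs of edges meet, so a correspondence of edges
  replaces an isomorphism and isolated vertices never enter.\<close>

lemma match_num_eq:
  assumes "inj_on F I" "inj_on F' I"
    and "\<And>x y. x \<in> I \<Longrightarrow> y \<in> I \<Longrightarrow> x \<noteq> y \<Longrightarrow> F x \<inter> F y = {} \<longleftrightarrow> F' x \<inter> F' y = {}"
  shows "match_num (F ` I) n = match_num (F' ` I) n"
proof -
  have "(\<forall>x\<in>M. \<forall>y\<in>M. x \<noteq> y \<longrightarrow> F x \<inter> F y = {}) \<longleftrightarrow> (\<forall>x\<in>M. \<forall>y\<in>M. x \<noteq> y \<longrightarrow> F' x \<inter> F' y = {})"
    if "M \<subseteq> I" for M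
    using that assms(3) by (meson subsetD)
  then show ?thesis
    unfolding match_num_image[OF assms(1)] match_num_image[OF assms(2)]
    by (intro arg_cong[where f = card] Collect_cong conj_cong refl)
qed

lemma path_Int_path: "path_edge r i \<inter> path_edge r i' = {} \<longleftrightarrow> i \<noteq> i' \<and> i' \<noteq> Suc i \<and> i \<noteq> Suc i'"
  unfolding path_edge_eq by (simp add: image_iff) blast

lemma path_Int_pend: "path_edge r i \<inter> pend_edge r k = {} \<longleftrightarrow> k \<noteq> i \<and> k \<noteq> Suc i"
  and pend_Int_path: "pend_edge r k \<inter> path_edge r i = {} \<longleftrightarrow> k \<noteq> i \<and> k \<noteq> Suc i"
  unfolding path_edge_eq pend_edge_eq by (auto simp: image_iff)

lemma pend_Int_pend: "pend_edge r k \<inter> pend_edge r k' = {} \<longleftrightarrow> k \<noteq> k'"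
  unfolding pend_edge_eq by (auto simp: image_iff)

section \<open>Connectedness, cardinalities and the recursion at the linking edge\<close>

context linked_spine
begin

lemma connected:
  assumes connG: "hg_connected VG EG"
  shows "hg_connected verts edges"
proof -
  define A where "A = {(a, b). \<exists>e\<in>edges. a \<in> e \<and> b \<in> e}"
  have sym: "sym A" unfolding A_def sym_def by blast
  have symD: "(a, b) \<in> A\<^sup>* \<Longrightarrow> (b, a) \<in> A\<^sup>*" for a b
    using sym_rtrancl[OF sym] by (rule symD)
  have edge: "(a, b) \<in> A" if "e \<in> edges" "a \<in> e" "b \<in> e" for a b e
    using that unfolding A_def by blast
  have link_e: "link \<in> edges" unfolding edges_def by blast
  have spine_e: "Inl ` e \<in> edges" if "e \<in> spine_edges r" for e using that unfolding edges_def by blast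
  have path_e: "Inl ` path_edge r i \<in> edges" if "i \<in> {1..8}" for i
    using that by (intro spine_e) (auto simp: spine_edges_def)
  have PV1: "Suc m \<le> 9 \<Longrightarrow> (Inl (PV 1), Inl (PV (Suc m))) \<in> A\<^sup>*" for m
  proof (induction m)
    case (Suc m)
    have "(Inl (PV (Suc m)), Inl (PV (Suc (Suc m)))) \<in> A"
      by (rule edge[OF path_e[of "Suc m"]]) (use Suc.prems in auto)
    then show ?case using Suc by (meson Suc_leD rtrancl.rtrancl_into_rtrancl)
  qed simp
  have PV: "(Inl (PV 1), Inl (PV m)) \<in> A\<^sup>*" if "m \<in> {1..9}" for m
    using PV1[of "m - 1"] that by (cases m) auto
  have k9: "k \<in> {1..9}" using k by auto
  have "(Inr w, Inl (PV k)) \<in> A" by (rule edge[OF link_e]) auto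
  then have w1: "(Inr w, Inl (PV 1)) \<in> A\<^sup>*"
    using symD[OF PV[OF k9]] by (rule converse_rtrancl_into_rtrancl)
  \<comment> \<open>Every vertex is reached from \<open>w\<close>; symmetry of \<open>A\<close> then
    joins any two vertices.\<close>
  have reach: "(Inr w, a) \<in> A\<^sup>*" if a: "a \<in> verts" for a
  proof -
    consider "a \<in> link" | e v where "e \<in> spine_edges r" "v \<in> e" "a = Inl v" | g where "g \<in> VG" "a = Inr g"
      using a[unfolded verts_def] by auto
    then show ?thesis
    proof cases
      case 1
      have "(Inr w, a) \<in> A" by (rule edge[OF link_e _ 1]) simp
      then show ?thesis by blast
    next
      case 2
      then obtain m where m: "PV m \<in> e" unfolding spine_edges_def by (auto simp: path_edge_eq pend_edge_eq)
      then have "m \<in> {1..9}" using 2(1) PV_in_spine by blast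
      then have "(Inr w, Inl (PV m)) \<in> A\<^sup>*" using w1 PV by (meson rtrancl_trans)
      moreover have "(Inl (PV m), a) \<in> A" by (rule edge[OF spine_e[OF 2(1)]]) (use 2 m in auto)
      ultimately show ?thesis by (rule rtrancl_into_rtrancl)
    next
      case 3
      have "(w, g) \<in> {(a, b). \<exists>e\<in>EG. a \<in> e \<and> b \<in> e}\<^sup>*"
        using connG w 3(1) unfolding hg_connected_def by blast
      then have "(Inr w, Inr g) \<in> A\<^sup>*"
      proof (induction rule: rtrancl_induct)
        case (step b c)
        then obtain e where e: "e \<in> EG" "b \<in> e" "c \<in> e" by blast
        have "(Inr b, Inr c) \<in> A"
          by (rule edge[of "Inr ` e"]) (use e in \<open>auto simp: edges_def\<close>)
        then show ?case by (rule rtrancl_into_rtrancl[OF step.IH])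
      qed simp
      then show ?thesis using 3 by simp
    qed
  qed
  then show ?thesis
    unfolding hg_connected_def A_def[symmetric] by (meson symD rtrancl_trans)
qed

lemma edges_minus_link: "edges - {link} = image Inl ` spine_edges r \<union> image Inr ` EG"
proof -
  have "link \<notin> image Inl ` spine_edges r \<union> image Inr ` EG" using link_neq by auto
  then show ?thesis unfolding edges_def by simp
qed

lemma card_edges: "card edges = Suc (card (image Inl ` spine_edges r \<union> image Inr ` EG :: (rvert + 'a) set set))"
proof -
  have "finite edges" using uniform by (rule uniform_hg_finite_edges)
  moreover have "link \<in> edges" unfolding edges_def by blast
  ultimately show ?thesis unfolding edges_minus_link[symmetric] by (rule card.remove)
qed

text \<open>\<open>PV k\<close> and \<open>w\<close> are already counted, so \<open>link\<close>
  adds just its \<open>r - 2\<close> other vertices. The count is the same for both values of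
  \<open>k\<close>.\<close>

lemma card_verts: "card verts = card (Inl ` \<Union> (spine_edges r) \<union> Inr ` VG :: (rvert + 'a) set) + (r - 2)"
proof -
  let ?B = "Inl ` \<Union> (spine_edges r) \<union> Inr ` VG :: (rvert + 'a) set"
  let ?N = "Inl ` NV k ` ({1..r - 1} - {j}) :: (rvert + 'a) set"
  have "PV k \<in> \<Union> (spine_edges r)" using k PV_in_spine by auto
  then have V: "verts = ?B \<union> ?N" unfolding verts_def link_def using w by auto
  have "finite verts" using uniform unfolding uniform_hg_def by blast
  moreover have "?B \<inter> ?N = {}"
  proof -
    have "NV k l \<notin> \<Union> (spine_edges r)" for l unfolding NV_in_spine using k by auto
    then show ?thesis by blast
  qed
  ultimately have "card verts = card ?B + card ?N"
    unfolding V by (intro card_Un_disjoint) auto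
  also have "card ?N = r - 2"
    unfolding image_image using card_inner by (subst card_image) (auto simp: inj_on_def)
  finally show ?thesis .
qed

text \<open>The linking edge meets other edges only in \<open>PV k\<close> and \<open>w\<close>: as
  \<open>k\<close> is not 2 or 5, no spine edge contains a vertex \<open>NV k l\<close>.\<close>

lemma disjoint_from_link:
  "{f\<in>edges. f \<inter> link = {}} = image Inl ` {e\<in>spine_edges r. PV k \<notin> e} \<union> image Inr ` {e\<in>EG. w \<notin> e}"
proof -
  have spine: "Inl ` e \<inter> link = {} \<longleftrightarrow> PV k \<notin> e" if e: "e \<in> spine_edges r" for e
  proof -
    have "NV k l \<notin> \<Union> (spine_edges r)" for l unfolding NV_in_spine using k by auto
    then have "NV k l \<notin> e" for l using e by blast
    then show ?thesis unfolding link_def by auto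
  qed
  have "Inr ` e \<inter> link = {} \<longleftrightarrow> w \<notin> e" for e unfolding link_def by auto
  moreover have "link \<inter> link \<noteq> {}" unfolding link_def by auto
  ultimately show ?thesis using spine unfolding edges_def by auto
qed

text \<open>The first summand does not involve \<open>k\<close>, so comparing the two hypergraphs
  reduces to the second.\<close>

lemma match_num_edges_Suc:
  "match_num edges (Suc n) = match_num (image Inl ` spine_edges r \<union> image Inr ` EG :: (rvert + 'a) set set) (Suc n)
     + match_num (image Inl ` {e\<in>spine_edges r. PV k \<notin> e} \<union> image Inr ` {e\<in>EG. w \<notin> e} :: (rvert + 'a) set set) n"
proof -
  have "finite edges" using uniform by (rule uniform_hg_finite_edges)
  then show ?thesis
    using match_num_Suc[of edges link n] unfolding edges_minus_link disjoint_from_link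
    by (simp add: edges_def link_def)
qed

end

lemma filter_insert: "{x\<in>insert a A. P x} = (if P a then insert a {x\<in>A. P x} else {x\<in>A. P x})"
  by auto

lemma spine_avoiding_3:
  "{e\<in>spine_edges r. PV 3 \<notin> e} = set [path_edge r 1, pend_edge r 2, path_edge r 4, pend_edge r 5,
     path_edge r 5, path_edge r 6, path_edge r 7, path_edge r 8]"
proof -
  have "{e\<in>spine_edges r. PV 3 \<notin> e} = path_edge r ` {1, 4, 5, 6, 7, 8} \<union> pend_edge r ` {2, 5}"
    unfolding spine_edges_def atLeast1_atMost8
    by (simp only: image_insert image_empty Un_insert_left Un_empty_left filter_insert
        PV_in_path_edge PV_in_pend_edge) simp
  then show ?thesis by (simp only: image_insert image_empty list.set) blast
qed

lemma spine_avoiding_6: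
  "{e\<in>spine_edges r. PV 6 \<notin> e} = set [path_edge r 7, path_edge r 8, path_edge r 1, pend_edge r 2,
     path_edge r 2, path_edge r 3, path_edge r 4, pend_edge r 5]"
proof -
  have "{e\<in>spine_edges r. PV 6 \<notin> e} = path_edge r ` {1, 2, 3, 4, 7, 8} \<union> pend_edge r ` {2, 5}"
    unfolding spine_edges_def atLeast1_atMost8
    by (simp only: image_insert image_empty Un_insert_left Un_empty_left filter_insert
        PV_in_path_edge PV_in_pend_edge) simp
  then show ?thesis by (simp only: image_insert image_empty list.set) blast
qed

text \<open>Deleting \<open>v_3\<close> or \<open>v_6\<close> leaves in both cases a loose path of length 2 and a star with three
  edges, one of which is prolonged by a loose path of length 3. The lists above match the two.\<close>

lemma match_num_avoiding:
  "match_num (image Inl ` {e\<in>spine_edges r. PV 3 \<notin> e} \<union> image Inr ` EG :: (rvert + 'a) set set) n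
       = match_num (image Inl ` {e\<in>spine_edges r. PV 6 \<notin> e} \<union> image Inr ` EG) n"
proof -
  define L3 where "L3 = [path_edge r 1, pend_edge r 2, path_edge r 4, pend_edge r 5,
     path_edge r 5, path_edge r 6, path_edge r 7, path_edge r 8]"
  define L6 where "L6 = [path_edge r 7, path_edge r 8, path_edge r 1, pend_edge r 2,
     path_edge r 2, path_edge r 3, path_edge r 4, pend_edge r 5]"
  \<comment> \<open>Edges are indexed by list positions and by the edges of the second part, so
    equal positions in \<open>L3\<close> and \<open>L6\<close> correspond and the second part is
    fixed.\<close>
  define F :: "rvert set list \<Rightarrow> nat + 'a set \<Rightarrow> (rvert + 'a) set"
    where "F L a = (case a of Inl i \<Rightarrow> Inl ` (L ! i) | Inr e \<Rightarrow> Inr ` e)" for L a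
  define I :: "(nat + 'a set) set" where "I = Inl ` {..<8} \<union> Inr ` EG"
  have img: "F L ` I = image Inl ` set L \<union> image Inr ` EG" if "length L = 8" for L
  proof -
    have "set L = (!) L ` {..<8}" using that by (auto simp: set_conv_nth)
    then show ?thesis unfolding I_def image_Un image_image by (simp add: F_def image_image)
  qed
  have inj: "inj_on (F L) I" if "length L = 8" "distinct L" "{} \<notin> set L" for L
  proof -
    \<comment> \<open>\<open>EG\<close> is arbitrary here and may contain the empty set; nonempty
      list entries keep the two kinds of images apart.\<close>
    have "Inl ` (L ! i) \<noteq> (Inr ` e :: (rvert + 'a) set)" if "i < 8" for i e
    proof -
      have "L ! i \<noteq> {}" using that \<open>length L = 8\<close> \<open>{} \<notin> set L\<close> by (metis nth_mem)
      then show ?thesis by blast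
    qed
    note neq = this this[symmetric]
    show ?thesis
    proof (rule inj_onI)
      fix x y assume "x \<in> I" "y \<in> I" "F L x = F L y"
      then show "x = y"
        using neq that(1,2) unfolding I_def F_def
        by (cases x; cases y) (auto simp: inj_image_eq_iff nth_eq_iff_index_eq)
    qed
  qed
  have conflict: "\<forall>i<8. \<forall>i'<8. i \<noteq> i' \<longrightarrow> (L3 ! i \<inter> L3 ! i' = {} \<longleftrightarrow> L6 ! i \<inter> L6 ! i' = {})"
    unfolding L3_def L6_def
    by (simp add: eval_nat_numeral All_less_Suc path_Int_path path_Int_pend pend_Int_path pend_Int_pend)
  have disj: "Inl ` a \<inter> Inl ` b = ({} :: (rvert + 'a) set) \<longleftrightarrow> a \<inter> b = {}"
      "Inl ` a \<inter> Inr ` e = ({} :: (rvert + 'a) set) \<longleftrightarrow> True"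
      "Inr ` e \<inter> Inl ` a = ({} :: (rvert + 'a) set) \<longleftrightarrow> True" for a b and e :: "'a set"
    by auto
  have ne_edge: "path_edge r i \<noteq> {}" "pend_edge r i \<noteq> {}" for i
    unfolding path_edge_eq pend_edge_eq by auto
  have "match_num (F L3 ` I) n = match_num (F L6 ` I) n"
  proof (rule match_num_eq)
    show "inj_on (F L3) I" by (rule inj) (use ne_edge in \<open>auto simp: L3_def\<close>)
    show "inj_on (F L6) I" by (rule inj) (use ne_edge in \<open>auto simp: L6_def\<close>)
    fix x y assume "x \<in> I" "y \<in> I" "x \<noteq> y"
    then show "F L3 x \<inter> F L3 y = {} \<longleftrightarrow> F L6 x \<inter> F L6 y = {}"
      using conflict unfolding I_def F_def by (cases x; cases y) (auto simp only: sum.case disj)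
  qed
  then show ?thesis
    unfolding spine_avoiding_3 spine_avoiding_6
    using img[of L3] img[of L6] unfolding L3_def L6_def by simp
qed

section \<open>The two coalescences\<close>

text \<open>Both paths have length 8; the attachment indices are 2, 3, 5 and 2, 5, 6, so they differ
  only in the pendent edge that gets glued.\<close>

lemma R_edges_1124: "R_edges r 1 1 2 4 = insert (pend_edge r 3) (spine_edges r)"
  and R_edges_1313: "R_edges r 1 3 1 3 = insert (pend_edge r 6) (spine_edges r)"
proof -
  have path: "{path_edge r i | i. 1 \<le> i \<and> i \<le> 8} = path_edge r ` {1..8}" by (auto simp: image_def)
  have set: "P \<union> {a, b, c} = insert b (P \<union> {a, c})" "P \<union> {a, b, c} = insert c (P \<union> {a, b})"
    for P :: "rvert set set" and a b c by blast+
  have "R_edges r 1 1 2 4 = {path_edge r i | i. 1 \<le> i \<and> i \<le> 8} \<union> {pend_edge r 2, pend_edge r 3, pend_edge r 5}"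
    unfolding R_edges_def by (simp add: eval_nat_numeral)
  then show "R_edges r 1 1 2 4 = insert (pend_edge r 3) (spine_edges r)"
    unfolding path spine_edges_def set(1) by simp
  have "R_edges r 1 3 1 3 = {path_edge r i | i. 1 \<le> i \<and> i \<le> 8} \<union> {pend_edge r 2, pend_edge r 5, pend_edge r 6}"
    unfolding R_edges_def by (simp add: eval_nat_numeral)
  then show "R_edges r 1 3 1 3 = insert (pend_edge r 6) (spine_edges r)"
    unfolding path spine_edges_def set(2) by simp
qed

text \<open>\<open>PV k\<close> also lies on the path edge with index \<open>k\<close>, so its
  degree is at least 2; a vertex of degree 1 must be one of the new ones.\<close>

lemma pendent_vertex_of_pend_edge:
  assumes "u \<in> pend_edge r k" and "hg_degree (insert (pend_edge r k) (spine_edges r)) u = 1" and "k \<in> {2..8}"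
  obtains j where "u = NV k j" "j \<in> {1..r - 1}"
proof -
  have "u \<noteq> PV k"
  proof
    assume u: "u = PV k"
    obtain e where "{e \<in> insert (pend_edge r k) (spine_edges r). u \<in> e} = {e}"
      using assms(2) unfolding hg_degree_def by (rule card_1_singletonE)
    moreover have "path_edge r k \<in> spine_edges r" unfolding spine_edges_def using assms(3) by auto
    moreover have "u \<in> path_edge r k" by (simp add: u)
    ultimately have "path_edge r k = e" "pend_edge r k = e" using assms(1) by blast+
    then show False using path_edge_neq_pend_edge(1) by metis
  qed
  then show thesis using assms(1) that unfolding pend_edge_eq by auto
qed

theorem theorem3:
  fixes r :: nat and VG :: "'a set" and EG :: "'a set set" and w :: 'a and u v :: rvert
  assumes "r \<ge> 3"
    and "supertree r VG EG" and "w \<in> VG"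
    and "u \<in> pend_edge r 3" and "hg_degree (R_edges r 1 1 2 4) u = 1"
    and "v \<in> pend_edge r 6" and "hg_degree (R_edges r 1 3 1 3) v = 1"
  shows "spectral_radius r (coal_verts (R_verts r 1 1 2 4) u VG w) (coal_edges (R_edges r 1 1 2 4) u EG w)
         = spectral_radius r (coal_verts (R_verts r 1 3 1 3) v VG w) (coal_edges (R_edges r 1 3 1 3) v EG w)
       \<and> matching_energy r (coal_verts (R_verts r 1 1 2 4) u VG w) (coal_edges (R_edges r 1 1 2 4) u EG w)
         = matching_energy r (coal_verts (R_verts r 1 3 1 3) v VG w) (coal_edges (R_edges r 1 3 1 3) v EG w)"
proof -
  let ?V1 = "coal_verts (R_verts r 1 1 2 4) u VG w" and ?E1 = "coal_edges (R_edges r 1 1 2 4) u EG w"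
  let ?V2 = "coal_verts (R_verts r 1 3 1 3) v VG w" and ?E2 = "coal_edges (R_edges r 1 3 1 3) v EG w"
  have unifG: "uniform_hg r VG EG" and connG: "hg_connected VG EG"
    using assms(2) unfolding supertree_def by blast+
  obtain j where j: "u = NV 3 j" "j \<in> {1..r - 1}"
    using pendent_vertex_of_pend_edge[of u r 3] assms(4,5) unfolding R_edges_1124 by auto
  obtain j' where j': "v = NV 6 j'" "j' \<in> {1..r - 1}"
    using pendent_vertex_of_pend_edge[of v r 6] assms(6,7) unfolding R_edges_1313 by auto
  interpret H1: linked_spine r 3 j VG EG w by unfold_locales (use assms unifG j in auto)
  interpret H2: linked_spine r 6 j' VG EG w by unfold_locales (use assms unifG j' in auto)
  have 1: "?V1 = H1.verts" "?E1 = H1.edges"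
    unfolding R_verts_def j(1) by (rule H1.coal_verts_eq[OF R_edges_1124], rule H1.coal_edges_eq[OF R_edges_1124])
  have 2: "?V2 = H2.verts" "?E2 = H2.edges"
    unfolding R_verts_def j'(1) by (rule H2.coal_verts_eq[OF R_edges_1313], rule H2.coal_edges_eq[OF R_edges_1313])
  have r: "r \<ge> 1" using assms(1) by simp
  have ne: "H1.verts \<noteq> {}" "H2.verts \<noteq> {}" "H1.edges \<noteq> {}"
    using H1.Inr_in_verts H2.Inr_in_verts assms(3) unfolding H1.edges_def by blast+
  obtain lam x where lam: "lam > 0" and x: "positive_eigenvector r H1.verts H1.edges lam x"
    using positive_eigenvector_exists[OF H1.uniform H1.connected[OF connG] ne(3) r] by blast
  note sys = H1.eigenvector_imp_spine_eq[OF lam x]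
  have "sqrt (lam ^ r) > 0" using lam by simp
  then obtain z where z: "spine_eq (sqrt (lam ^ r)) 6 (sqrt (x (Inr w) ^ r)) z"
      "z 6 = sqrt (x (Inl (PV 3)) ^ r)"
    using spine_eq_transfer[OF _ sys(1)] by blast
  \<comment> \<open>The entries on \<Gamma> are reused. Because \<open>z 6\<close> is the old value
    at \<open>v_3\<close>, the term contributed by the linking edge at \<open>w\<close> is
    unchanged.\<close>
  obtain x' where "positive_eigenvector r H2.verts H2.edges lam x'"
    using H2.spine_eq_imp_eigenvector[of lam "\<lambda>g. x (Inr g)" z, OF lam z(1) sys(2)[folded z(2)]] by blast
  then have "spectral_radius r H1.verts H1.edges = spectral_radius r H2.verts H2.edges"
    using spectral_radius_eq_positive_eigenvalue[OF H1.uniform r ne(1) x]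
      spectral_radius_eq_positive_eigenvalue[OF H2.uniform r ne(2)] by simp
  moreover have "match_num H1.edges n = match_num H2.edges n" for n
  proof (cases n)
    case 0
    then show ?thesis
      using uniform_hg_finite_edges[OF H1.uniform] uniform_hg_finite_edges[OF H2.uniform]
      by (simp add: match_num_0)
  next
    case (Suc m)
    \<comment> \<open>\<open>match_num_avoiding\<close> is used with the edges of \<Gamma> that miss
      \<open>w\<close>.\<close>
    show ?thesis
      unfolding Suc H1.match_num_edges_Suc H2.match_num_edges_Suc match_num_avoiding ..
  qed
  then have "matching_poly r H1.verts H1.edges = matching_poly r H2.verts H2.edges"
    unfolding matching_poly_def H1.card_edges H2.card_edges H1.card_verts H2.card_verts by simp
  then have "matching_energy r H1.verts H1.edges = matching_energy r H2.verts H2.edges"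
    unfolding matching_energy_def by simp
  ultimately show ?thesis unfolding 1 2 by blast
qed

end
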